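(* Let $\mathcal H$ be a separable infinite-dimensional complex Hilbert space and let $\hat{\mathcal K}_{odd}=\mathcal K(\mathcal H)\oplus\mathcal K(\mathcal H)$ with the grading $(a,b)\mapsto(b,a)$. Suppose $\sigma$ is a Real structure on $\hat{\mathcal K}_{odd}$. Then there exists an anti-unitary $J:\mathcal H\to\mathcal H$ with $J^2=\pm1$ such that either $$(\hat{\mathcal K}_{odd},\sigma)\cong(\mathcal K(\mathcal H)\hat\otimes\mathbb Cl_1,\mathrm{Ad}_J\hat\otimes cl_{0,1})\quad\text{or}\quad(\hat{\mathcal K}_{odd},\sigma)\cong(\mathcal K(\mathcal H)\hat\otimes\mathbb Cl_1,\mathrm{Ad}_J\hat\otimes cl_{1,0})$$ as Real graded $C^*$-algebras.
   Context: A Real structure on a $\mathbb Z_2$-graded complex $C^*$-algebra is a conjugate-linear $*$-automorphism $\sigma$ with $\sigma^2=\mathrm{id}$ commuting with the grading automorphism; the algebra with its Real structure is a Real graded $C^*$-algebra, and isomorphisms of these intertwine gradings and Real structures. $\mathrm{Ad}_J(T)=JTJ^{-1}$. $\mathcal K(\mathcal H)$ is trivially graded and $\hat\otimes$ is the graded tensor product. $\mathbb Cl_1=\mathbb C\oplus\mathbb C$ has grading $(a,b)\mapsto(b,a)$; $cl_{0,1}$ is the Real structure $(a,b)\mapsto(\bar a,\bar b)$, with fixed algebra $Cl_{0,1}=\mathbb R\oplus\mathbb R$, and $cl_{1,0}$ is $(a,b)\mapsto(\bar b,\bar a)$, with fixed algebra isomorphic to $Cl_{1,0}=\mathbb C$.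 *)

theory Defs
  imports "HOL-Analysis.Analysis" "HOL-Library.Poly_Mapping"
begin

section \<open>Complex Hilbert spaces and operators on them\<close>

text \<open>
  The inner product is conjugate-linear in the first argument. Positivity and definiteness
  are contained in \<open>cinner_self\<close>.
\<close>

class complex_hilbert_space = banach +
  fixes scaleC :: "complex \<Rightarrow> 'a \<Rightarrow> 'a"  (infixr \<open>*\<^sub>C\<close> 75)
    and cinner :: "'a \<Rightarrow> 'a \<Rightarrow> complex"
  assumes scaleC_add_right: "c *\<^sub>C (x + y) = c *\<^sub>C x + c *\<^sub>C y"
    and scaleC_add_left: "(c + d) *\<^sub>C x = c *\<^sub>C x + d *\<^sub>C x"
    and scaleC_scaleC: "c *\<^sub>C d *\<^sub>C x = (c * d) *\<^sub>C x"
    and scaleR_scaleC: "r *\<^sub>R x = complex_of_real r *\<^sub>C x"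
    and cinner_commute: "cinner x y = cnj (cinner y x)"
    and cinner_add_right: "cinner x (y + z) = cinner x y + cinner x z"
    and cinner_scaleC_right: "cinner x (c *\<^sub>C y) = c * cinner x y"
    and cinner_self: "cinner x x = complex_of_real ((norm x)\<^sup>2)"

interpretation complex_vector:
  vector_space "scaleC :: complex \<Rightarrow> 'a \<Rightarrow> 'a::complex_hilbert_space"
proof
  show "1 *\<^sub>C x = x" for x :: 'a
    using scaleR_scaleC[of 1 x] by simp
qed (simp_all add: scaleC_add_right scaleC_add_left scaleC_scaleC)

definition infinite_dimensional :: "'h::complex_hilbert_space itself \<Rightarrow> bool" where
  "infinite_dimensional _ \<longleftrightarrow>
     \<not> (\<exists>B :: 'h set. finite B \<and> complex_vector.span B = UNIV)"

text \<open>Compact operators are automatically bounded, so boundedness is not required separately.\<close>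

definition compact_operator :: "('h::complex_hilbert_space \<Rightarrow> 'h) \<Rightarrow> bool" where
  "compact_operator T \<longleftrightarrow>
     Vector_Spaces.linear scaleC scaleC T \<and> compact (closure (T ` cball 0 1))"

definition cadjoint ::
    "('h::complex_hilbert_space \<Rightarrow> 'h) \<Rightarrow> ('h \<Rightarrow> 'h)" where
  "cadjoint T = (THE S. \<forall>x y. cinner (S x) y = cinner x (T y))"

definition antiunitary :: "('h::complex_hilbert_space \<Rightarrow> 'h) \<Rightarrow> bool" where
  "antiunitary J \<longleftrightarrow> surj J \<and> (\<forall>x y. J (x + y) = J x + J y) \<and>
     (\<forall>c x. J (c *\<^sub>C x) = cnj c *\<^sub>C J x) \<and>
     (\<forall>x y. cinner (J x) (J y) = cnj (cinner x y))"

definition Ad :: "('h \<Rightarrow> 'h) \<Rightarrow> ('h \<Rightarrow> 'h) \<Rightarrow> ('h \<Rightarrow> 'h)" where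
  "Ad J T = J \<circ> T \<circ> inv J"


section \<open>Real graded algebras\<close>

text \<open>
  The norm of a \<open>C\<^sup>*\<close>-algebra is determined by its \<open>*\<close>-algebra structure, and
  \<open>*\<close>-isomorphisms of \<open>C\<^sup>*\<close>-algebras are automatically isometric, so the norm is not
  recorded. The operations are meaningful on the carrier only. \<open>ggrade\<close> is the grading
  automorphism.
\<close>

record 'a graded_star_algebra =
  gcarrier :: "'a set"
  gadd :: "'a \<Rightarrow> 'a \<Rightarrow> 'a"
  gscale :: "complex \<Rightarrow> 'a \<Rightarrow> 'a"
  gmult :: "'a \<Rightarrow> 'a \<Rightarrow> 'a"
  gstar :: "'a \<Rightarrow> 'a"
  ggrade :: "'a \<Rightarrow> 'a"

text \<open>Bijectivity of a Real structure follows from its being an involution.\<close>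

definition real_structure :: "'a graded_star_algebra \<Rightarrow> ('a \<Rightarrow> 'a) \<Rightarrow> bool" where
  "real_structure A \<sigma> \<longleftrightarrow>
     (\<forall>x\<in>gcarrier A. \<sigma> x \<in> gcarrier A \<and> \<sigma> (\<sigma> x) = x) \<and>
     (\<forall>x\<in>gcarrier A. \<forall>y\<in>gcarrier A. \<sigma> (gadd A x y) = gadd A (\<sigma> x) (\<sigma> y)) \<and>
     (\<forall>c. \<forall>x\<in>gcarrier A. \<sigma> (gscale A c x) = gscale A (cnj c) (\<sigma> x)) \<and>
     (\<forall>x\<in>gcarrier A. \<forall>y\<in>gcarrier A. \<sigma> (gmult A x y) = gmult A (\<sigma> x) (\<sigma> y)) \<and>
     (\<forall>x\<in>gcarrier A. \<sigma> (gstar A x) = gstar A (\<sigma> x)) \<and>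
     (\<forall>x\<in>gcarrier A. \<sigma> (ggrade A x) = ggrade A (\<sigma> x))"

fun real_graded_isomorphic ::
    "'a graded_star_algebra \<times> ('a \<Rightarrow> 'a) \<Rightarrow>
     'b graded_star_algebra \<times> ('b \<Rightarrow> 'b) \<Rightarrow> bool" where
  "real_graded_isomorphic (A, \<sigma>) (B, \<tau>) \<longleftrightarrow>
     (\<exists>\<phi>. bij_betw \<phi> (gcarrier A) (gcarrier B) \<and>
       (\<forall>x\<in>gcarrier A. \<forall>y\<in>gcarrier A. \<phi> (gadd A x y) = gadd B (\<phi> x) (\<phi> y)) \<and>
       (\<forall>c. \<forall>x\<in>gcarrier A. \<phi> (gscale A c x) = gscale B c (\<phi> x)) \<and>
       (\<forall>x\<in>gcarrier A. \<forall>y\<in>gcarrier A. \<phi> (gmult A x y) = gmult B (\<phi> x) (\<phi> y)) \<and>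
       (\<forall>x\<in>gcarrier A. \<phi> (gstar A x) = gstar B (\<phi> x)) \<and>
       (\<forall>x\<in>gcarrier A. \<phi> (ggrade A x) = ggrade B (\<phi> x)) \<and>
       (\<forall>x\<in>gcarrier A. \<phi> (\<sigma> x) = \<tau> (\<phi> x)))"

definition compact_operators :: "('h::complex_hilbert_space \<Rightarrow> 'h) graded_star_algebra" where
  "compact_operators =
     \<lparr> gcarrier = {T. compact_operator T},
       gadd = (\<lambda>S T x. S x + T x),
       gscale = (\<lambda>c T x. c *\<^sub>C T x),
       gmult = (\<circ>),
       gstar = cadjoint,
       ggrade = id \<rparr>"

text \<open>\<open>A \<oplus> A\<close> graded by the flip; the grading of \<open>A\<close> itself is ignored.\<close>

definition flip_sum :: "'a graded_star_algebra \<Rightarrow> ('a \<times> 'a) graded_star_algebra" where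
  "flip_sum A =
     \<lparr> gcarrier = gcarrier A \<times> gcarrier A,
       gadd = (\<lambda>(a, b) (a', b'). (gadd A a a', gadd A b b')),
       gscale = (\<lambda>c (a, b). (gscale A c a, gscale A c b)),
       gmult = (\<lambda>(a, b) (a', b'). (gmult A a a', gmult A b b')),
       gstar = (\<lambda>(a, b). (gstar A a, gstar A b)),
       ggrade = (\<lambda>(a, b). (b, a)) \<rparr>"

definition K_odd ::
    "(('h::complex_hilbert_space \<Rightarrow> 'h) \<times> ('h \<Rightarrow> 'h)) graded_star_algebra" where
  "K_odd = flip_sum compact_operators"

definition complex_numbers :: "complex graded_star_algebra" where
  "complex_numbers =
     \<lparr> gcarrier = UNIV, gadd = (+), gscale = (*), gmult = (*), gstar = cnj, ggrade = id \<rparr>"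

definition Cl1 :: "(complex \<times> complex) graded_star_algebra" where
  "Cl1 = flip_sum complex_numbers"

definition cl01 :: "complex \<times> complex \<Rightarrow> complex \<times> complex" where
  "cl01 = (\<lambda>(a, b). (cnj a, cnj b))"

definition cl10 :: "complex \<times> complex \<Rightarrow> complex \<times> complex" where
  "cl10 = (\<lambda>(a, b). (cnj b, cnj a))"


section \<open>The graded tensor product\<close>

text \<open>
  The algebraic graded tensor product of \<open>A\<close> and \<open>B\<close>: the free complex vector space on
  \<open>gcarrier A \<times> gcarrier B\<close> modulo the bilinearity relations. If one of two
  \<open>C\<^sup>*\<close>-algebras is finite-dimensional (as \<open>Cl1\<close> is), it is complete in its unique
  \<open>C\<^sup>*\<close>-norm, so that it is also the \<open>C\<^sup>*\<close>-algebraic graded tensor product.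
\<close>

definition fscale :: "complex \<Rightarrow> ('i \<Rightarrow>\<^sub>0 complex) \<Rightarrow> ('i \<Rightarrow>\<^sub>0 complex)" where
  "fscale c = Poly_Mapping.map (\<lambda>z. c * z)"

definition gen :: "'a \<Rightarrow> 'b \<Rightarrow> ('a \<times> 'b \<Rightarrow>\<^sub>0 complex)" where
  "gen a b = Poly_Mapping.single (a, b) 1"

definition bilinearity_relators ::
    "'a graded_star_algebra \<Rightarrow> 'b graded_star_algebra \<Rightarrow> ('a \<times> 'b \<Rightarrow>\<^sub>0 complex) set" where
  "bilinearity_relators A B =
     {gen (gadd A a a') b - gen a b - gen a' b | a a' b.
        a \<in> gcarrier A \<and> a' \<in> gcarrier A \<and> b \<in> gcarrier B} \<union>
     {gen a (gadd B b b') - gen a b - gen a b' | a b b'.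
        a \<in> gcarrier A \<and> b \<in> gcarrier B \<and> b' \<in> gcarrier B} \<union>
     {gen (gscale A c a) b - fscale c (gen a b) | c a b.
        a \<in> gcarrier A \<and> b \<in> gcarrier B} \<union>
     {gen a (gscale B c b) - fscale c (gen a b) | c a b.
        a \<in> gcarrier A \<and> b \<in> gcarrier B}"

definition free_space ::
    "'a graded_star_algebra \<Rightarrow> 'b graded_star_algebra \<Rightarrow> ('a \<times> 'b \<Rightarrow>\<^sub>0 complex) set" where
  "free_space A B = {f. Poly_Mapping.keys f \<subseteq> gcarrier A \<times> gcarrier B}"

definition tensor_rel ::
    "'a graded_star_algebra \<Rightarrow> 'b graded_star_algebra \<Rightarrow>
     (('a \<times> 'b \<Rightarrow>\<^sub>0 complex) \<times> ('a \<times> 'b \<Rightarrow>\<^sub>0 complex)) set" where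
  "tensor_rel A B =
     {(f, g). f \<in> free_space A B \<and> g \<in> free_space A B \<and>
        f - g \<in> module.span fscale (bilinearity_relators A B)}"

text \<open>Linear and conjugate-linear extension from the basis to the free vector space:\<close>

definition lin_ext :: "('i \<Rightarrow> ('j \<Rightarrow>\<^sub>0 complex)) \<Rightarrow> ('i \<Rightarrow>\<^sub>0 complex) \<Rightarrow> ('j \<Rightarrow>\<^sub>0 complex)" where
  "lin_ext h f = (\<Sum>p\<in>Poly_Mapping.keys f. fscale (Poly_Mapping.lookup f p) (h p))"

definition conj_lin_ext ::
    "('i \<Rightarrow> ('j \<Rightarrow>\<^sub>0 complex)) \<Rightarrow> ('i \<Rightarrow>\<^sub>0 complex) \<Rightarrow> ('j \<Rightarrow>\<^sub>0 complex)" where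
  "conj_lin_ext h f =
     (\<Sum>p\<in>Poly_Mapping.keys f. fscale (cnj (Poly_Mapping.lookup f p)) (h p))"

text \<open>The homogeneous component of degree \<open>k\<close> (for \<open>k = 0, 1\<close>):\<close>

definition hom_part :: "'a graded_star_algebra \<Rightarrow> nat \<Rightarrow> 'a \<Rightarrow> 'a" where
  "hom_part A k x = gscale A (1 / 2) (gadd A x (gscale A ((- 1) ^ k) (ggrade A x)))"

text \<open>
  For homogeneous elements
  \<open>(a \<otimes> b) (a' \<otimes> b') = (-1)\<^bsup>|b| |a'|\<^esup> a a' \<otimes> b b'\<close> and
  \<open>(a \<otimes> b)\<^sup>* = (-1)\<^bsup>|a| |b|\<^esup> a\<^sup>* \<otimes> b\<^sup>*\<close>;
  general elements are split into their homogeneous components.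
\<close>

definition gen_mult ::
    "'a graded_star_algebra \<Rightarrow> 'b graded_star_algebra \<Rightarrow>
     'a \<times> 'b \<Rightarrow> 'a \<times> 'b \<Rightarrow> ('a \<times> 'b \<Rightarrow>\<^sub>0 complex)" where
  "gen_mult A B = (\<lambda>(a, b) (a', b').
     \<Sum>i<2. \<Sum>j<2. fscale ((- 1) ^ (i * j))
       (gen (gmult A a (hom_part A j a')) (gmult B (hom_part B i b) b')))"

definition gen_star ::
    "'a graded_star_algebra \<Rightarrow> 'b graded_star_algebra \<Rightarrow>
     'a \<times> 'b \<Rightarrow> ('a \<times> 'b \<Rightarrow>\<^sub>0 complex)" where
  "gen_star A B = (\<lambda>(a, b).
     \<Sum>i<2. \<Sum>j<2. fscale ((- 1) ^ (i * j))
       (gen (gstar A (hom_part A i a)) (gstar B (hom_part B j b))))"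

definition graded_tensor ::
    "'a graded_star_algebra \<Rightarrow> 'b graded_star_algebra \<Rightarrow>
     ('a \<times> 'b \<Rightarrow>\<^sub>0 complex) set graded_star_algebra"  (infixl \<open>\<otimes>\<^sub>g\<close> 70) where
  "A \<otimes>\<^sub>g B =
     \<lparr> gcarrier = free_space A B // tensor_rel A B,
       gadd = (\<lambda>X Y. \<Union>f\<in>X. \<Union>g\<in>Y. tensor_rel A B `` {f + g}),
       gscale = (\<lambda>c X. \<Union>f\<in>X. tensor_rel A B `` {fscale c f}),
       gmult = (\<lambda>X Y. \<Union>f\<in>X. \<Union>g\<in>Y.
         tensor_rel A B `` {lin_ext (\<lambda>p. lin_ext (gen_mult A B p) g) f}),
       gstar = (\<lambda>X. \<Union>f\<in>X. tensor_rel A B `` {conj_lin_ext (gen_star A B) f}),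
       ggrade = (\<lambda>X. \<Union>f\<in>X.
         tensor_rel A B `` {lin_ext (\<lambda>(a, b). gen (ggrade A a) (ggrade B b)) f}) \<rparr>"

text \<open>\<open>\<sigma> \<otimes> \<tau>\<close> for conjugate-linear, grading-preserving maps \<open>\<sigma>\<close> and \<open>\<tau>\<close>:\<close>

definition tensor_conj_map ::
    "'a graded_star_algebra \<Rightarrow> 'b graded_star_algebra \<Rightarrow> ('a \<Rightarrow> 'a) \<Rightarrow> ('b \<Rightarrow> 'b) \<Rightarrow>
     ('a \<times> 'b \<Rightarrow>\<^sub>0 complex) set \<Rightarrow> ('a \<times> 'b \<Rightarrow>\<^sub>0 complex) set" where
  "tensor_conj_map A B \<sigma> \<tau> = (\<lambda>X. \<Union>f\<in>X.
     tensor_rel A B `` {conj_lin_ext (\<lambda>(a, b). gen (\<sigma> a) (\<tau> b)) f})"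

end

theory Submission
  imports Defs
begin

text \<open>
  A Real structure \<open>\<sigma>\<close> on \<open>K \<oplus> K\<close> is a ring automorphism, so it permutes the minimal
  projections, which are the rank-one projections of the two summands. Let \<open>e\<close> be a unit vector
  and let \<open>f\<close> span the range of the image of the projection \<open>|e\<rangle>\<langle>e|\<close> of the first summand. If
  this image lies in the first summand, then \<open>\<sigma>\<close> maps the left ideal of the operators \<open>|x\<rangle>\<langle>e|\<close>,
  which is a copy of the Hilbert space, onto the left ideal of the operators \<open>|y\<rangle>\<langle>f|\<close>. The
  resulting map \<open>J\<close> of vectors is antiunitary. Multiplicativity of \<open>\<sigma>\<close> and compatibility with the
  flip give \<open>\<sigma> = Ad\<^sub>J \<oplus> Ad\<^sub>J\<close>, and \<open>\<sigma>\<^sup>2 = id\<close> makes \<open>J\<^sup>2\<close> commute with all rank-one operators,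
  so that \<open>J\<^sup>2\<close> is a scalar, which is \<open>1\<close> or \<open>-1\<close> because it commutes with the conjugate-linear
  isometry \<open>J\<close>. If the image lies in the second summand, the same applies to \<open>\<sigma>\<close> followed by the
  flip. This is \<open>K_odd_real_structure_classification\<close>.

  The tensor product with \<open>Cl1\<close> is \<open>K \<oplus> K\<close> again: the two characters of \<open>Cl1\<close> give two coordinate
  operators of a formal combination of elementary tensors, and since \<open>(1, 0)\<close> and \<open>(0, 1)\<close> are a
  basis of \<open>Cl1\<close>, two combinations are congruent exactly if their coordinates agree
  (\<open>tensor_rel_iff\<close>). All operations on the tensor product therefore can be computed in
  coordinates. Because \<open>K\<close> is even, no signs appear, and \<open>Ad\<^sub>J \<otimes> cl01\<close> and \<open>Ad\<^sub>J \<otimes> cl10\<close> become the two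
  kinds of Real structure found above, preserving and exchanging the summands respectively.

  The adjoint is an operation of \<open>K\<close>, so Hilbert space theory is needed to see that it exists
  (\<open>Riesz_representation\<close>) and preserves compactness (\<open>compact_operator_cadjoint\<close>).
\<close>

section \<open>Hilbert space geometry\<close>

lemma cinner_add_left: "cinner (x + y) z = cinner x z + cinner y z"
  by (metis cinner_add_right cinner_commute complex_cnj_add)

lemma cinner_scaleC_left: "cinner (c *\<^sub>C x) y = cnj c * cinner x y"
  by (metis cinner_commute cinner_scaleC_right complex_cnj_mult)

lemma cinner_zero_right [simp]: "cinner x 0 = 0"
  by (metis add_cancel_left_left cinner_add_right)

lemma cinner_zero_left [simp]: "cinner 0 x = 0"
  by (metis add_cancel_left_left cinner_add_left)

lemma cinner_diff_right: "cinner x (y - z) = cinner x y - cinner x z"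
  by (metis add_diff_cancel_right' cinner_add_right diff_add_cancel)

lemma cinner_diff_left: "cinner (x - y) z = cinner x z - cinner y z"
  by (metis add_diff_cancel_right' cinner_add_left diff_add_cancel)

lemma cinner_sum_left: "cinner (\<Sum>i\<in>F. f i) y = (\<Sum>i\<in>F. cinner (f i) y)"
  by (induction F rule: infinite_finite_induct) (simp_all add: cinner_add_left)

lemma cinner_sum_right: "cinner x (\<Sum>i\<in>F. f i) = (\<Sum>i\<in>F. cinner x (f i))"
  by (induction F rule: infinite_finite_induct) (simp_all add: cinner_add_right)

lemma cinner_ext_left:
  assumes "\<And>y. cinner x y = cinner x' y"
  shows "x = x'"
proof -
  have "cinner (x - x') (x - x') = 0"
    using assms by (simp add: cinner_diff_left)
  then show ?thesis by (simp add: cinner_self)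
qed

lemma norm_sq_eq_cinner: "(norm x)\<^sup>2 = Re (cinner x x)"
  by (simp add: cinner_self)

lemma norm_scaleC: "norm (c *\<^sub>C x) = cmod c * norm x"
proof -
  have "(norm (c *\<^sub>C x))\<^sup>2 = Re (cnj c * c * of_real ((norm x)\<^sup>2))"
    unfolding cinner_self[symmetric] mult.assoc
    by (simp add: norm_sq_eq_cinner[of "c *\<^sub>C x"] cinner_scaleC_left cinner_scaleC_right algebra_simps del: of_real_power)
  also have "cnj c * c = of_real ((cmod c)\<^sup>2)"
    by (simp only: complex_norm_square mult.commute)
  finally have "(norm (c *\<^sub>C x))\<^sup>2 = (cmod c * norm x)\<^sup>2"
    by (simp add: power_mult_distrib flip: of_real_mult of_real_power)
  then show ?thesis by (simp add: power2_eq_iff_nonneg)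
qed

lemma norm_sq_add: "(norm (x + y))\<^sup>2 = (norm x)\<^sup>2 + (norm y)\<^sup>2 + 2 * Re (cinner x y)"
proof -
  have "Re (cinner y x) = Re (cinner x y)"
    by (subst cinner_commute) simp
  then show ?thesis
    by (simp add: norm_sq_eq_cinner cinner_add_left cinner_add_right)
qed

lemma norm_sq_diff: "(norm (x - y))\<^sup>2 = (norm x)\<^sup>2 + (norm y)\<^sup>2 - 2 * Re (cinner x y)"
proof -
  have "Re (cinner y x) = Re (cinner x y)"
    by (subst cinner_commute) simp
  then show ?thesis
    by (simp add: norm_sq_eq_cinner cinner_diff_left cinner_diff_right)
qed

text \<open>
  The norm satisfies the triangle inequality by assumption; squaring it bounds the real part
  of the inner product, and rotating one argument turns the real part into the modulus.
\<close>

lemma cinner_Cauchy_Schwarz: "cmod (cinner x y) \<le> norm x * norm y"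
proof -
  have Re_le: "Re (cinner x z) \<le> norm x * norm z" for z
  proof -
    have "(norm (x + z))\<^sup>2 \<le> (norm x + norm z)\<^sup>2"
      by (rule power_mono[OF norm_triangle_ineq]) simp
    then show ?thesis by (simp add: norm_sq_add power2_sum)
  qed
  define c where "c = cnj (sgn (cinner x y))"
  have "cmod c \<le> 1" by (simp add: c_def norm_sgn)
  have "cnj (cinner x y) * cinner x y = complex_of_real (cmod (cinner x y)) * complex_of_real (cmod (cinner x y))"
    by (simp only: mult.commute[of "cnj _"] complex_norm_square[symmetric] power2_eq_square of_real_mult)
  then have "c * cinner x y = complex_of_real (cmod (cinner x y))"
    by (simp add: c_def sgn_eq)
  then have "cmod (cinner x y) = Re (cinner x (c *\<^sub>C y))"
    by (simp add: cinner_scaleC_right)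
  also have "\<dots> \<le> norm x * (cmod c * norm y)"
    using Re_le[of "c *\<^sub>C y"] by (simp add: norm_scaleC)
  also have "\<dots> \<le> norm x * norm y"
    using \<open>cmod c \<le> 1\<close> by (intro mult_left_mono mult_left_le_one_le) auto
  finally show ?thesis .
qed

text \<open>
  Riesz representation: the functional \<open>l\<close> is represented by the minimizer of
  \<open>\<parallel>x\<parallel>\<^sup>2 - 2 Re (l x)\<close>. The parallelogram law makes every minimizing sequence Cauchy, and
  the first-order condition at the minimizer is the representation of \<open>Re l\<close>; the imaginary
  part follows by replacing \<open>v\<close> with \<open>\<i> v\<close>.
\<close>

lemma Riesz_representation:
  fixes l :: "'h::complex_hilbert_space \<Rightarrow> complex"
  assumes add: "\<And>x y. l (x + y) = l x + l y"
    and scale: "\<And>c x. l (c *\<^sub>C x) = c * l x"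
    and bound: "\<And>x. cmod (l x) \<le> B * norm x"
  obtains z where "\<And>x. l x = cinner z x"
proof -
  define q where "q x = (norm x)\<^sup>2 - 2 * Re (l x)" for x
  define m where "m = Inf (range q)"
  have lR: "l (r *\<^sub>R x) = of_real r * l x" for r x
    by (simp add: scaleR_scaleC scale)
  have lin: "bounded_linear l"
    using bound by (intro bounded_linear_intro[where K = B])
      (auto simp: add lR scaleR_conv_of_real mult.commute)
  have "- B\<^sup>2 \<le> q x" for x
  proof -
    have "Re (l x) \<le> B * norm x"
      using bound[of x] complex_Re_le_cmod[of "l x"] by linarith
    moreover have "0 \<le> (norm x - B)\<^sup>2" by simp
    ultimately show ?thesis by (simp add: q_def power2_diff mult.commute mult.left_commute)
  qed
  then have bdd: "bdd_below (range q)" by (intro bdd_belowI[of _ "- B\<^sup>2"]) auto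
  have m_le: "m \<le> q x" for x
    unfolding m_def by (rule cInf_lower[OF _ bdd]) simp
  have "\<exists>x. q x < m + 1 / real (Suc n)" for n
    using cInf_lessD[of "range q" "m + 1 / real (Suc n)"] unfolding m_def by auto
  then obtain s where s: "\<And>n. q (s n) < m + 1 / real (Suc n)" by metis
  have parallelogram: "(norm (x - y))\<^sup>2 \<le> 2 * (q x - m) + 2 * (q y - m)" for x y
  proof -
    have "(norm (x - y))\<^sup>2 = 2 * q x + 2 * q y - 4 * q ((1/2) *\<^sub>R (x + y))"
      by (simp add: q_def norm_sq_add norm_sq_diff lR add power_divide) (simp add: field_simps)
    then show ?thesis using m_le[of "(1/2) *\<^sub>R (x + y)"] by simp
  qed
  have "Cauchy s"
  proof (rule CauchyI)
    fix e :: real assume "0 < e"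
    obtain N where N: "4 / real (Suc N) < e\<^sup>2"
      using reals_Archimedean[of "e\<^sup>2 / 4"] \<open>0 < e\<close> by (auto simp: field_simps inverse_eq_divide)
    have close: "q (s n) - m \<le> 1 / real (Suc N)" if "n \<ge> N" for n
    proof -
      have "1 / real (Suc n) \<le> 1 / real (Suc N)" using that by (simp add: frac_le)
      then show ?thesis using s[of n] by linarith
    qed
    have "norm (s i - s j) < e" if "i \<ge> N" "j \<ge> N" for i j
    proof -
      have "(norm (s i - s j))\<^sup>2 < e\<^sup>2"
        using parallelogram[of "s i" "s j"] close[OF that(1)] close[OF that(2)] N by simp
      then show ?thesis using \<open>0 < e\<close> by (simp add: power_less_imp_less_base)
    qed
    then show "\<exists>M. \<forall>i\<ge>M. \<forall>j\<ge>M. norm (s i - s j) < e" by blast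
  qed
  then obtain z where z: "s \<longlonglongrightarrow> z" by (auto simp: Cauchy_convergent_iff convergent_def)
  have "(\<lambda>n. q (s n)) \<longlonglongrightarrow> q z"
    unfolding q_def by (intro tendsto_intros z bounded_linear.tendsto[OF lin])
  moreover have "(\<lambda>n. m + 1 / real (Suc n)) \<longlonglongrightarrow> m + 0"
    by (intro tendsto_intros LIMSEQ_Suc lim_1_over_n)
  ultimately have "q z \<le> m + 0"
    by (rule LIMSEQ_le) (use s in \<open>auto intro: less_imp_le\<close>)
  then have qz: "q z \<le> q x" for x using m_le[of x] by simp
  have Re_eq: "Re (l v) = Re (cinner z v)" for v
  proof -
    define a where "a = (norm v)\<^sup>2"
    define b where "b = Re (cinner z v) - Re (l v)"
    have quad: "0 \<le> t\<^sup>2 * a + 2 * t * b" for t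
    proof -
      have "Re (cinner z (t *\<^sub>R v)) = t * Re (cinner z v)"
        by (simp add: scaleR_scaleC cinner_scaleC_right)
      then show ?thesis
        using qz[of "z + t *\<^sub>R v"]
        by (simp add: q_def norm_sq_add lR add a_def b_def power_mult_distrib algebra_simps)
    qed
    have "0 \<le> a" by (simp add: a_def)
    \<comment> \<open>The quadratic in \<open>t\<close> is negative at \<open>- b / (a + 1)\<close> unless \<open>b = 0\<close>.\<close>
    have eq: "(- b / (a + 1))\<^sup>2 * a + 2 * (- b / (a + 1)) * b = - (b\<^sup>2 * (a + 2)) / (a + 1)\<^sup>2"
      using \<open>0 \<le> a\<close> by (simp add: divide_simps power2_eq_square) (simp add: algebra_simps)
    have "0 \<le> - (b\<^sup>2 * (a + 2)) / (a + 1)\<^sup>2"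
      using quad[of "- b / (a + 1)"] unfolding eq .
    then have "b\<^sup>2 * (a + 2) \<le> 0"
      using \<open>0 \<le> a\<close> by (auto simp: zero_le_divide_iff divide_le_0_iff)
    then have "b = 0"
      using \<open>0 \<le> a\<close> by (simp add: mult_le_0_iff)
    then show ?thesis by (simp add: b_def)
  qed
  have "l v = cinner z v" for v
    using Re_eq[of v] Re_eq[of "\<i> *\<^sub>C v"]
    by (simp add: complex_eq_iff scale cinner_scaleC_right)
  then show ?thesis by (rule that)
qed

section \<open>Compact operators\<close>

abbreviation clinear :: "('h::complex_hilbert_space \<Rightarrow> 'h) \<Rightarrow> bool" where
  "clinear \<equiv> Vector_Spaces.linear scaleC scaleC"

lemma clinear_iff:
  "clinear T \<longleftrightarrow> (\<forall>x y. T (x + y) = T x + T y) \<and> (\<forall>c x. T (c *\<^sub>C x) = c *\<^sub>C T x)"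
  by (auto simp: Vector_Spaces.linear_iff complex_vector.vector_space_axioms)

lemma clinear_zero: "clinear T \<Longrightarrow> T 0 = 0"
  unfolding clinear_iff by (metis add_cancel_left_left)

lemma clinear_diff: "clinear T \<Longrightarrow> T (x - y) = T x - T y"
  unfolding clinear_iff by (metis add_diff_cancel_right' diff_add_cancel)

lemma clinear_sum: "clinear T \<Longrightarrow> T (\<Sum>i\<in>F. f i) = (\<Sum>i\<in>F. T (f i))"
  by (induction F rule: infinite_finite_induct) (simp_all add: clinear_zero, simp add: clinear_iff)

text \<open>
  Relative compactness by subsequences of the set itself, which spares the later proofs from
  describing limit points of images of the unit ball.
\<close>

lemma compact_closure_sequentially:
  fixes S :: "'a::metric_space set"
  assumes "\<And>x. (\<forall>n::nat. x n \<in> S) \<Longrightarrow> \<exists>l r. strict_mono r \<and> (x \<circ> r) \<longlonglongrightarrow> l"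
  shows "compact (closure S)"
  unfolding compact_eq_seq_compact_metric seq_compact_def
proof (intro allI impI)
  fix y :: "nat \<Rightarrow> 'a" assume y: "\<forall>n. y n \<in> closure S"
  have "\<exists>x\<in>S. dist x (y n) < 1 / real (Suc n)" for n
    using y by (simp add: closure_approachable)
  then obtain x where x: "\<And>n. x n \<in> S" "\<And>n. dist (x n) (y n) < 1 / real (Suc n)" by metis
  then obtain l r where r: "strict_mono r" and l: "(x \<circ> r) \<longlonglongrightarrow> l" using assms[of x] by blast
  have "(\<lambda>n. dist (x n) (y n)) \<longlonglongrightarrow> 0"
    by (rule tendsto_sandwich[of "\<lambda>_. 0" _ _ "\<lambda>n. 1 / real (Suc n)"])
      (auto intro!: always_eventually less_imp_le[OF x(2)] LIMSEQ_Suc lim_1_over_n simp del: of_nat_Suc)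
  then have d: "((\<lambda>n. dist (x n) (y n)) \<circ> r) \<longlonglongrightarrow> 0" using r by (rule LIMSEQ_subseq_LIMSEQ)
  have "(y \<circ> r) \<longlonglongrightarrow> l"
    unfolding tendsto_dist_iff[of "y \<circ> r"]
    by (rule tendsto_sandwich[of "\<lambda>_. 0" _ _ "\<lambda>n. dist (x (r n)) (y (r n)) + dist (x (r n)) l"])
      (use tendsto_add[of "\<lambda>n. dist (x (r n)) (y (r n))" 0 _ "\<lambda>n. dist (x (r n)) l" 0] l d in
        \<open>auto simp: o_def tendsto_dist_iff[of "\<lambda>n. x (r n)"] dist_triangle3\<close>)
  moreover have "l \<in> closure S"
    unfolding closure_sequential by (intro exI[of _ "x \<circ> r"]) (use l x(1) in simp)
  ultimately show "\<exists>l\<in>closure S. \<exists>r. strict_mono r \<and> (y \<circ> r) \<longlonglongrightarrow> l" using r by blast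
qed

text \<open>
  Membership in the unit ball is relaxed to boundedness by rescaling, so that the criterion
  can be applied to images of bounded sequences under bounded operators.
\<close>

lemma compact_operator_subsequence:
  assumes "compact_operator T" and bounded: "\<And>n. norm (x n) \<le> B"
  shows "\<exists>l r. strict_mono (r :: nat \<Rightarrow> nat) \<and> (\<lambda>n. T (x (r n))) \<longlonglongrightarrow> l"
proof -
  define b where "b = \<bar>B\<bar> + 1"
  have b: "b > 0" "\<And>n. norm (x n) \<le> b" using bounded by (auto simp: b_def) (meson abs_ge_self add_increasing2 order_trans zero_le_one)
  define y where "y n = complex_of_real (1 / b) *\<^sub>C x n" for n
  have T: "clinear T" and cpt: "seq_compact (closure (T ` cball 0 1))"
    using assms(1) by (auto simp: compact_operator_def compact_eq_seq_compact_metric)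
  have "norm (y n) \<le> 1" for n
    using b(1) b(2)[of n] by (simp add: y_def norm_scaleC norm_divide)
  then have "T (y n) \<in> closure (T ` cball 0 1)" for n
    by (intro set_mp[OF closure_subset] imageI) simp
  then obtain r l where r: "strict_mono r" and l: "((\<lambda>n. T (y n)) \<circ> r) \<longlonglongrightarrow> l"
    using cpt unfolding seq_compact_def by meson
  have "T (x n) = b *\<^sub>R T (y n)" for n
    using T b(1) by (simp add: y_def clinear_iff scaleR_scaleC scaleC_scaleC)
  moreover have "(\<lambda>n. b *\<^sub>R T (y (r n))) \<longlonglongrightarrow> b *\<^sub>R l"
    using l by (intro tendsto_intros) (simp add: o_def)
  ultimately show ?thesis using r by auto
qed

lemma compact_operatorI:
  assumes "clinear T"
    and "\<And>x. (\<And>n. norm (x n) \<le> 1) \<Longrightarrow> \<exists>l r. strict_mono (r :: nat \<Rightarrow> nat) \<and> (\<lambda>n. T (x (r n))) \<longlonglongrightarrow> l"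
  shows "compact_operator T"
  unfolding compact_operator_def
proof (intro conjI assms(1) compact_closure_sequentially)
  fix y :: "nat \<Rightarrow> 'a" assume "\<forall>n. y n \<in> T ` cball 0 1"
  then have "\<forall>n. \<exists>x. norm x \<le> 1 \<and> y n = T x" by (force simp: image_iff)
  then obtain x where x: "\<And>n. norm (x n) \<le> 1" "\<And>n. y n = T (x n)" by metis
  show "\<exists>l r. strict_mono r \<and> (y \<circ> r) \<longlonglongrightarrow> l"
    using assms(2)[of x] x by (auto simp: o_def)
qed

lemma compact_operator_clinear: "compact_operator T \<Longrightarrow> clinear T"
  by (simp add: compact_operator_def)

lemma compact_operator_bounded:
  assumes "compact_operator T"
  obtains B where "0 \<le> B" "\<And>x. norm (T x) \<le> B * norm x"
proof -
  have T: "clinear T" and "bounded (T ` cball 0 1)"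
    using assms by (auto simp: compact_operator_def intro: bounded_subset[OF compact_imp_bounded closure_subset])
  then obtain B where B: "\<And>x. norm x \<le> 1 \<Longrightarrow> norm (T x) \<le> B" by (force simp: bounded_iff)
  have "norm (T x) \<le> B * norm x" for x
  proof (cases "x = 0")
    case False
    have "T x = norm x *\<^sub>R T (complex_of_real (1 / norm x) *\<^sub>C x)"
      using T False by (simp add: clinear_iff scaleR_scaleC scaleC_scaleC)
    then show ?thesis
      using B[of "complex_of_real (1 / norm x) *\<^sub>C x"] False
      by (simp add: norm_scaleC norm_divide mult.commute mult_left_mono)
  qed (simp add: T clinear_zero)
  moreover have "0 \<le> B" using B[of 0] T by (simp add: clinear_zero)
  ultimately show ?thesis by (rule that[rotated])
qed

lemma clinear_tendsto:
  assumes "clinear T" "\<And>x. norm (T x) \<le> B * norm x" "s \<longlonglongrightarrow> l"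
  shows "(\<lambda>n. T (s n)) \<longlonglongrightarrow> T l"
proof -
  have "bounded_linear T"
    using assms(1,2) by (intro bounded_linear_intro[where K = B])
      (auto simp: clinear_iff scaleR_scaleC mult.commute)
  then show ?thesis using assms(3) by (rule bounded_linear.tendsto)
qed

lemma compact_operator_add:
  assumes "compact_operator S" "compact_operator T"
  shows "compact_operator (\<lambda>x. S x + T x)"
proof (rule compact_operatorI)
  show "clinear (\<lambda>x. S x + T x)"
    using assms[THEN compact_operator_clinear] by (simp add: clinear_iff scaleC_add_right)
  fix x :: "nat \<Rightarrow> 'a" assume x: "\<And>n. norm (x n) \<le> 1"
  obtain r l where r: "strict_mono r" "(\<lambda>n. S (x (r n))) \<longlonglongrightarrow> l"
    using compact_operator_subsequence[OF assms(1), of x 1] x by blast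
  obtain r' l' where r': "strict_mono r'" "(\<lambda>n. T (x (r (r' n)))) \<longlonglongrightarrow> l'"
    using compact_operator_subsequence[OF assms(2), of "\<lambda>n. x (r n)" 1] x by blast
  have "(\<lambda>n. S (x (r (r' n)))) \<longlonglongrightarrow> l"
    using LIMSEQ_subseq_LIMSEQ[OF r(2) r'(1)] by (simp add: o_def)
  from tendsto_add[OF this r'(2)]
  show "\<exists>l r. strict_mono r \<and> (\<lambda>n. S (x (r n)) + T (x (r n))) \<longlonglongrightarrow> l"
    using strict_mono_o[OF r(1) r'(1)] by (auto simp: o_def)
qed

lemma compact_operator_comp_left:
  assumes "compact_operator T" "clinear S" "\<And>x. norm (S x) \<le> B * norm x"
  shows "compact_operator (S \<circ> T)"
proof (rule compact_operatorI)
  show "clinear (S \<circ> T)"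
    using compact_operator_clinear[OF assms(1)] assms(2) by (simp add: clinear_iff)
  fix x :: "nat \<Rightarrow> 'a" assume x: "\<And>n. norm (x n) \<le> 1"
  obtain r l where r: "strict_mono r" "(\<lambda>n. T (x (r n))) \<longlonglongrightarrow> l"
    using compact_operator_subsequence[OF assms(1), of x 1] x by blast
  then show "\<exists>l r. strict_mono r \<and> (\<lambda>n. (S \<circ> T) (x (r n))) \<longlonglongrightarrow> l"
    using clinear_tendsto[OF assms(2,3)] by auto
qed

lemma compact_operator_comp_right:
  assumes "compact_operator T" "clinear S" "\<And>x. norm (S x) \<le> B * norm x"
  shows "compact_operator (T \<circ> S)"
proof (rule compact_operatorI)
  show "clinear (T \<circ> S)"
    using compact_operator_clinear[OF assms(1)] assms(2) by (simp add: clinear_iff)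
  fix x :: "nat \<Rightarrow> 'a" assume x: "\<And>n. norm (x n) \<le> 1"
  have "norm (S (x n)) \<le> \<bar>B\<bar>" for n
  proof -
    have "B * norm (x n) \<le> \<bar>B\<bar> * 1" using x[of n] by (intro mult_mono) auto
    then show ?thesis using assms(3)[of "x n"] by simp
  qed
  then show "\<exists>l r. strict_mono r \<and> (\<lambda>n. (T \<circ> S) (x (r n))) \<longlonglongrightarrow> l"
    using compact_operator_subsequence[OF assms(1), of "\<lambda>n. S (x n)" "\<bar>B\<bar>"] by simp
qed

lemma compact_operator_comp:
  assumes "compact_operator S" "compact_operator T"
  shows "compact_operator (S \<circ> T)"
  using assms by (metis compact_operator_bounded compact_operator_clinear compact_operator_comp_left)

lemma compact_operator_scaleC:
  assumes "compact_operator T"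
  shows "compact_operator (\<lambda>x. c *\<^sub>C T x)"
proof -
  have "clinear (\<lambda>x::'a. c *\<^sub>C x)"
    by (simp add: clinear_iff scaleC_add_right scaleC_scaleC mult.commute)
  then have "compact_operator ((\<lambda>x. c *\<^sub>C x) \<circ> T)"
    by (rule compact_operator_comp_left[OF assms, where B = "cmod c"]) (simp add: norm_scaleC)
  then show ?thesis by (simp add: o_def)
qed

lemma compact_operator_zero: "compact_operator (\<lambda>x. 0)"
  by (rule compact_operatorI) (auto simp: clinear_iff intro: strict_mono_id)

lemma compact_operator_sum:
  "(\<And>i. i \<in> F \<Longrightarrow> compact_operator (T i)) \<Longrightarrow> compact_operator (\<lambda>x. \<Sum>i\<in>F. T i x)"
  by (induction F rule: infinite_finite_induct) (simp_all add: compact_operator_zero compact_operator_add)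

subsection \<open>Adjoints\<close>

lemma cadjoint_eqI:
  assumes "\<And>x y. cinner (S x) y = cinner x (T y)"
  shows "cadjoint T = S"
  unfolding cadjoint_def
proof (rule the_equality)
  fix S' assume "\<forall>x y. cinner (S' x) y = cinner x (T y)"
  then show "S' = S" using assms by (intro ext cinner_ext_left) simp
qed (use assms in blast)

lemma cinner_cadjoint:
  assumes "compact_operator T"
  shows "cinner (cadjoint T x) y = cinner x (T y)"
proof -
  obtain B where B: "\<And>x. norm (T x) \<le> B * norm x"
    using compact_operator_bounded[OF assms] by metis
  have T: "clinear T" using assms by (rule compact_operator_clinear)
  have "\<exists>z. \<forall>y. cinner x (T y) = cinner z y" for x
  proof -
    have "cmod (cinner x (T y)) \<le> (norm x * B) * norm y" for y
    proof -
      have "cmod (cinner x (T y)) \<le> norm x * norm (T y)" by (rule cinner_Cauchy_Schwarz)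
      also have "\<dots> \<le> norm x * (B * norm y)" using B by (intro mult_left_mono) auto
      finally show ?thesis by (simp add: mult.assoc)
    qed
    then obtain z where "\<And>y. cinner x (T y) = cinner z y"
      using Riesz_representation[of "\<lambda>y. cinner x (T y)" "norm x * B"] T
      by (auto simp: clinear_iff cinner_add_right cinner_scaleC_right)
    then show ?thesis by blast
  qed
  then obtain S where "\<And>x y. cinner x (T y) = cinner (S x) y" by metis
  then show ?thesis by (subst cadjoint_eqI[of S]) simp_all
qed

lemma clinear_cadjoint:
  assumes "compact_operator T"
  shows "clinear (cadjoint T)"
  unfolding clinear_iff
  by (intro conjI allI cinner_ext_left)
    (simp_all add: cinner_cadjoint[OF assms] cinner_add_left cinner_scaleC_left)

text \<open>
  Schauder's theorem in a Hilbert space: \<open>T T\<^sup>*\<close> is compact, and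
  \<open>\<parallel>T\<^sup>* x\<parallel>\<^sup>2 = \<langle>x, T T\<^sup>* x\<rangle>\<close>, so that a bounded sequence along which \<open>T T\<^sup>*\<close> converges is one
  along which \<open>T\<^sup>*\<close> is Cauchy.
\<close>

lemma compact_operator_cadjoint:
  assumes "compact_operator T"
  shows "compact_operator (cadjoint T)"
proof (rule compact_operatorI)
  let ?S = "cadjoint T"
  show S: "clinear ?S" using assms by (rule clinear_cadjoint)
  obtain B where B: "0 \<le> B" "\<And>x. norm (T x) \<le> B * norm x"
    using compact_operator_bounded[OF assms] by metis
  have norm_S: "(norm (?S x))\<^sup>2 \<le> norm x * norm (T (?S x))" for x
  proof -
    have "(norm (?S x))\<^sup>2 = Re (cinner x (T (?S x)))"
      by (simp add: norm_sq_eq_cinner cinner_cadjoint[OF assms])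
    then show ?thesis
      using cinner_Cauchy_Schwarz[of x "T (?S x)"] complex_Re_le_cmod[of "cinner x (T (?S x))"] by linarith
  qed
  have S_bound: "norm (?S x) \<le> B * norm x" for x
  proof (cases "norm (?S x) = 0")
    case False
    have "norm (?S x) * norm (?S x) \<le> norm x * (B * norm (?S x))"
      using norm_S[of x] B(2)[of "?S x"]
      by (metis mult_left_mono norm_ge_zero order_trans power2_eq_square)
    then show ?thesis using False by (simp add: mult.assoc[symmetric]) (simp add: mult.commute)
  qed (use B(1) in simp)
  have TS: "compact_operator (T \<circ> ?S)"
    by (rule compact_operator_comp_right[OF assms S S_bound])
  fix x :: "nat \<Rightarrow> 'a" assume x: "\<And>n. norm (x n) \<le> 1"
  obtain r l where r: "strict_mono r" and "(\<lambda>n. (T \<circ> ?S) (x (r n))) \<longlonglongrightarrow> l"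
    using compact_operator_subsequence[OF TS, of x 1] x by blast
  then have Cauchy: "Cauchy (\<lambda>n. T (?S (x (r n))))" by (auto intro: LIMSEQ_imp_Cauchy)
  have "Cauchy (\<lambda>n. ?S (x (r n)))"
  proof (rule CauchyI)
    fix e :: real assume "0 < e"
    then have "0 < e\<^sup>2 / 2" by simp
    then obtain M where M: "\<And>m n. m \<ge> M \<Longrightarrow> n \<ge> M \<Longrightarrow>
        norm (T (?S (x (r m))) - T (?S (x (r n)))) < e\<^sup>2 / 2"
      using CauchyD[OF Cauchy] by meson
    have "norm (?S (x (r m)) - ?S (x (r n))) < e" if "m \<ge> M" "n \<ge> M" for m n
    proof -
      let ?d = "x (r m) - x (r n)"
      have d: "?S ?d = ?S (x (r m)) - ?S (x (r n))"
        "T (?S ?d) = T (?S (x (r m))) - T (?S (x (r n)))"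
        using S compact_operator_clinear[OF assms] by (simp_all add: clinear_diff)
      have "norm ?d \<le> 2"
        using norm_triangle_ineq4[of "x (r m)" "x (r n)"] x[of "r m"] x[of "r n"] by linarith
      then have "(norm (?S ?d))\<^sup>2 \<le> 2 * norm (T (?S ?d))"
        using norm_S[of ?d] by (meson mult_right_mono norm_ge_zero order_trans)
      also have "\<dots> < e\<^sup>2" unfolding d(2) using M[OF that] by linarith
      finally show ?thesis using \<open>0 < e\<close> by (simp add: d power_less_imp_less_base)
    qed
    then show "\<exists>M. \<forall>m\<ge>M. \<forall>n\<ge>M. norm (?S (x (r m)) - ?S (x (r n))) < e" by blast
  qed
  then show "\<exists>l r. strict_mono r \<and> (\<lambda>n. ?S (x (r n))) \<longlonglongrightarrow> l"
    using r by (auto simp: Cauchy_convergent_iff convergent_def)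
qed

subsection \<open>Rank-one operators\<close>

definition rank_one :: "'h::complex_hilbert_space \<Rightarrow> 'h \<Rightarrow> 'h \<Rightarrow> 'h" where
  "rank_one x y = (\<lambda>z. cinner y z *\<^sub>C x)"

lemma clinear_rank_one: "clinear (rank_one x y)"
  by (simp add: clinear_iff rank_one_def cinner_add_right cinner_scaleC_right scaleC_add_left scaleC_scaleC)

lemma compact_operator_rank_one: "compact_operator (rank_one x y)"
proof (rule compact_operatorI[OF clinear_rank_one])
  fix z :: "nat \<Rightarrow> 'a" assume z: "\<And>n. norm (z n) \<le> 1"
  have "norm (cinner y (z n)) \<le> norm y" for n
    using cinner_Cauchy_Schwarz[of y "z n"] z[of n]
    by (metis mult_left_le norm_ge_zero order_trans)
  then have "bounded (range (\<lambda>n. cinner y (z n)))" by (auto simp: bounded_iff)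
  then obtain l r where r: "strict_mono r" "((\<lambda>n. cinner y (z n)) \<circ> r) \<longlonglongrightarrow> l"
    using bounded_imp_convergent_subsequence by metis
  have "bounded_linear (\<lambda>c. c *\<^sub>C x)"
    by (rule bounded_linear_intro[where K = "norm x"])
      (auto simp: scaleC_add_left scaleR_scaleC scaleC_scaleC norm_scaleC scaleR_conv_of_real)
  from bounded_linear.tendsto[OF this r(2)]
  show "\<exists>l r. strict_mono r \<and> (\<lambda>n. rank_one x y (z (r n))) \<longlonglongrightarrow> l"
    using r(1) by (auto simp: rank_one_def o_def)
qed

lemma clinear_comp_rank_one: "clinear T \<Longrightarrow> T \<circ> rank_one x y = rank_one (T x) y"
  by (auto simp: rank_one_def clinear_iff)

lemma rank_one_comp_rank_one:
  "rank_one x y \<circ> rank_one z w = (\<lambda>v. cinner y z *\<^sub>C rank_one x w v)"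
  by (auto simp: rank_one_def cinner_scaleC_right scaleC_scaleC mult.commute)

lemma cadjoint_rank_one: "cadjoint (rank_one x y) = rank_one y x"
proof (rule cadjoint_eqI)
  fix u v
  show "cinner (rank_one y x u) v = cinner u (rank_one x y v)"
    by (simp add: rank_one_def cinner_scaleC_left cinner_scaleC_right flip: cinner_commute[of u x])
qed

section \<open>Real structures on the odd algebra\<close>

lemma compact_operators_simps:
  "gcarrier compact_operators = {T. compact_operator T}"
  "gadd compact_operators S T = (\<lambda>x. S x + T x)"
  "gscale compact_operators c T = (\<lambda>x. c *\<^sub>C T x)"
  "gmult compact_operators S T = S \<circ> T"
  "gstar compact_operators T = cadjoint T"
  "ggrade compact_operators T = T"
  by (simp_all add: compact_operators_def)

lemma K_odd_simps:
  "(a, b) \<in> gcarrier K_odd \<longleftrightarrow> compact_operator a \<and> compact_operator b"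
  "gadd K_odd (a, b) (a', b') = (\<lambda>x. a x + a' x, \<lambda>x. b x + b' x)"
  "gscale K_odd c (a, b) = (\<lambda>x. c *\<^sub>C a x, \<lambda>x. c *\<^sub>C b x)"
  "gmult K_odd (a, b) (a', b') = (a \<circ> a', b \<circ> b')"
  "gstar K_odd (a, b) = (cadjoint a, cadjoint b)"
  "ggrade K_odd (a, b) = (b, a)"
  by (simp_all add: K_odd_def flip_sum_def compact_operators_def)

lemma cinner_cadjoint_right:
  "compact_operator T \<Longrightarrow> cinner x (cadjoint T y) = cinner (T x) y"
  by (metis cinner_cadjoint cinner_commute)

text \<open>
  Rank-one projections are the minimal projections: the corner that they cut out is
  one-dimensional. This is a property of the algebra alone, hence invariant under Real
  structures, and in a direct sum it confines the projection to one of the summands.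
\<close>

lemma minimal_projection_rank_one:
  fixes q r :: "'h::complex_hilbert_space \<Rightarrow> 'h"
  assumes q: "compact_operator q" "q \<circ> q = q" "cadjoint q = q" "q \<noteq> (\<lambda>_. 0)"
    and minimal: "\<And>S T. compact_operator S \<Longrightarrow> compact_operator T \<Longrightarrow>
      \<exists>c. q \<circ> S \<circ> q = (\<lambda>x. c *\<^sub>C q x) \<and> r \<circ> T \<circ> r = (\<lambda>x. c *\<^sub>C r x)"
    and r: "clinear r"
  shows "\<exists>f. norm f = 1 \<and> q = rank_one f f \<and> r = (\<lambda>_. 0)"
proof -
  have lin: "clinear q" using q(1) by (rule compact_operator_clinear)
  obtain v where v: "q v \<noteq> 0" using q(4) by auto
  define f where "f = complex_of_real (1 / norm (q v)) *\<^sub>C q v"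
  have "norm f = 1" using v by (simp add: f_def norm_scaleC norm_divide)
  have "q f = f"
    using lin q(2) by (simp add: f_def clinear_iff fun_eq_iff)
  obtain c where c: "q \<circ> rank_one f f \<circ> q = (\<lambda>x. c *\<^sub>C q x)"
    "r \<circ> (\<lambda>_. 0) \<circ> r = (\<lambda>x. c *\<^sub>C r x)"
    using minimal[OF compact_operator_rank_one compact_operator_zero] by metis
  have "q \<circ> rank_one f f \<circ> q = rank_one f f"
  proof
    fix x
    have "cinner f (q x) = cinner f x"
      using cinner_cadjoint[OF q(1), of f x] q(3) \<open>q f = f\<close> by simp
    then show "(q \<circ> rank_one f f \<circ> q) x = rank_one f f x"
      using lin \<open>q f = f\<close> by (simp add: rank_one_def clinear_iff)
  qed
  with c(1) have cq: "rank_one f f x = c *\<^sub>C q x" for x by metis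
  have "c *\<^sub>C f = 1 *\<^sub>C f"
    using cq[of f] \<open>q f = f\<close> \<open>norm f = 1\<close> by (simp add: rank_one_def cinner_self)
  then have "c = 1"
    using \<open>norm f = 1\<close> by (metis complex_vector.scale_right_imp_eq norm_zero zero_neq_one)
  have "q = rank_one f f" using cq \<open>c = 1\<close> by auto
  moreover have "r = (\<lambda>_. 0)"
    using c(2) \<open>c = 1\<close> r by (simp add: fun_eq_iff clinear_zero)
  ultimately show ?thesis using \<open>norm f = 1\<close> by blast
qed

locale K_odd_real_structure =
  fixes \<tau> :: "('h::complex_hilbert_space \<Rightarrow> 'h) \<times> ('h \<Rightarrow> 'h) \<Rightarrow> ('h \<Rightarrow> 'h) \<times> ('h \<Rightarrow> 'h)"
  assumes real_structure: "real_structure K_odd \<tau>"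
begin

lemma compact:
  assumes "compact_operator a" "compact_operator b"
  shows "compact_operator (fst (\<tau> (a, b)))" "compact_operator (snd (\<tau> (a, b)))"
proof -
  have "(fst (\<tau> (a, b)), snd (\<tau> (a, b))) \<in> gcarrier K_odd"
    using real_structure assms by (simp add: real_structure_def K_odd_simps)
  then show "compact_operator (fst (\<tau> (a, b)))" "compact_operator (snd (\<tau> (a, b)))"
    unfolding K_odd_simps by auto
qed

lemma involutive: "compact_operator a \<Longrightarrow> compact_operator b \<Longrightarrow> \<tau> (\<tau> (a, b)) = (a, b)"
  using real_structure unfolding real_structure_def by (metis K_odd_simps(1))

lemma add:
  assumes "compact_operator a" "compact_operator b" "compact_operator a'" "compact_operator b'"
    and "\<tau> (a, b) = (c, d)" "\<tau> (a', b') = (c', d')"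
  shows "\<tau> (\<lambda>x. a x + a' x, \<lambda>x. b x + b' x) = (\<lambda>x. c x + c' x, \<lambda>x. d x + d' x)"
proof -
  have "\<tau> (gadd K_odd (a, b) (a', b')) = gadd K_odd (\<tau> (a, b)) (\<tau> (a', b'))"
    using real_structure assms(1-4) by (simp add: real_structure_def K_odd_simps(1))
  then show ?thesis by (simp add: K_odd_simps assms)
qed

lemma scale:
  assumes "compact_operator a" "compact_operator b" "\<tau> (a, b) = (c, d)"
  shows "\<tau> (\<lambda>x. k *\<^sub>C a x, \<lambda>x. k *\<^sub>C b x) = (\<lambda>x. cnj k *\<^sub>C c x, \<lambda>x. cnj k *\<^sub>C d x)"
proof -
  have "\<tau> (gscale K_odd k (a, b)) = gscale K_odd (cnj k) (\<tau> (a, b))"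
    using real_structure assms(1,2) by (simp add: real_structure_def K_odd_simps(1))
  then show ?thesis by (simp add: K_odd_simps assms)
qed

lemma mult:
  assumes "compact_operator a" "compact_operator b" "compact_operator a'" "compact_operator b'"
    and "\<tau> (a, b) = (c, d)" "\<tau> (a', b') = (c', d')"
  shows "\<tau> (a \<circ> a', b \<circ> b') = (c \<circ> c', d \<circ> d')"
proof -
  have "\<tau> (gmult K_odd (a, b) (a', b')) = gmult K_odd (\<tau> (a, b)) (\<tau> (a', b'))"
    using real_structure assms(1-4) by (simp add: real_structure_def K_odd_simps(1))
  then show ?thesis by (simp add: K_odd_simps assms)
qed

lemma star:
  assumes "compact_operator a" "compact_operator b" "\<tau> (a, b) = (c, d)"
  shows "\<tau> (cadjoint a, cadjoint b) = (cadjoint c, cadjoint d)"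
proof -
  have "\<tau> (gstar K_odd (a, b)) = gstar K_odd (\<tau> (a, b))"
    using real_structure assms(1,2) by (simp add: real_structure_def K_odd_simps(1))
  then show ?thesis by (simp add: K_odd_simps assms)
qed

lemma swap:
  assumes "compact_operator a" "compact_operator b" "\<tau> (a, b) = (c, d)"
  shows "\<tau> (b, a) = (d, c)"
proof -
  have "\<tau> (ggrade K_odd (a, b)) = ggrade K_odd (\<tau> (a, b))"
    using real_structure assms(1,2) by (simp add: real_structure_def K_odd_simps(1))
  then show ?thesis by (simp add: K_odd_simps assms)
qed

lemma zero: "\<tau> (\<lambda>_. 0, \<lambda>_. 0) = (\<lambda>_. 0, \<lambda>_. 0)"
proof -
  obtain c d where "\<tau> (\<lambda>_. 0, \<lambda>_. 0) = (c, d)" by fastforce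
  from scale[OF compact_operator_zero compact_operator_zero this, of 0] show ?thesis by simp
qed

text \<open>
  The image of a minimal projection is a self-adjoint idempotent \<open>(q, r)\<close> with
  one-dimensional corner. One of the components is nonzero, and minimality then kills the other.
\<close>

lemma image_of_minimal_projection:
  assumes "norm e = 1"
  obtains f where "norm f = 1"
    "\<tau> (rank_one e e, \<lambda>_. 0) = (rank_one f f, \<lambda>_. 0) \<or>
     \<tau> (rank_one e e, \<lambda>_. 0) = (\<lambda>_. 0, rank_one f f)"
proof -
  let ?Z = "\<lambda>_::'h. 0::'h"
  let ?p = "rank_one e e"
  note cpt = compact_operator_rank_one compact_operator_zero
  obtain q r where qr: "\<tau> (?p, ?Z) = (q, r)" by fastforce
  have q: "compact_operator q" and r: "compact_operator r"
    using compact[of ?p ?Z] qr cpt by auto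
  have e: "cinner e e = 1" using assms by (simp add: cinner_self)
  have "?p \<circ> ?p = ?p" by (simp add: rank_one_comp_rank_one e)
  then have idem: "q \<circ> q = q" "r \<circ> r = r"
    using mult[OF cpt cpt qr qr] qr by (auto simp: o_def)
  have "cadjoint ?Z = ?Z" by (rule cadjoint_eqI) simp
  then have self_adj: "cadjoint q = q" "cadjoint r = r"
    using star[OF cpt qr] qr by (simp_all add: cadjoint_rank_one)
  have "?p e \<noteq> 0" using e assms by (auto simp: rank_one_def)
  then have "?p \<noteq> ?Z" by metis
  then have nonzero: "q \<noteq> ?Z \<or> r \<noteq> ?Z"
    using involutive[OF cpt, of e e] qr zero by auto
  have minimal: "\<exists>c. q \<circ> S \<circ> q = (\<lambda>x. c *\<^sub>C q x) \<and> r \<circ> T \<circ> r = (\<lambda>x. c *\<^sub>C r x)"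
    if "compact_operator S" "compact_operator T" for S T
  proof -
    obtain S' T' where ST': "\<tau> (S, T) = (S', T')" by fastforce
    have S': "compact_operator S'" "compact_operator T'" "\<tau> (S', T') = (S, T)"
      using compact[OF that] involutive[OF that] ST' by auto
    define c where "c = cinner e (S' e)"
    have "(?p \<circ> S' \<circ> ?p, ?Z \<circ> T' \<circ> ?Z) = (\<lambda>x. c *\<^sub>C ?p x, \<lambda>x. c *\<^sub>C ?Z x)"
      using compact_operator_clinear[OF S'(1)]
      by (auto simp: rank_one_def c_def clinear_iff cinner_scaleC_right scaleC_scaleC mult.commute)
    moreover have "\<tau> (?p \<circ> S' \<circ> ?p, ?Z \<circ> T' \<circ> ?Z) = (q \<circ> S \<circ> q, r \<circ> T \<circ> r)"
      by (intro mult cpt qr S' compact_operator_comp)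
    moreover note scale[OF cpt qr, of c]
    ultimately show ?thesis by (intro exI[of _ "cnj c"]) simp
  qed
  show ?thesis
  proof (cases "q = ?Z")
    case False
    then obtain f where "norm f = 1" "q = rank_one f f" "r = ?Z"
      using minimal_projection_rank_one[OF q idem(1) self_adj(1) _ minimal compact_operator_clinear[OF r]]
      by blast
    then show ?thesis using that qr by auto
  next
    case True
    then have "r \<noteq> ?Z" using nonzero by simp
    moreover have "\<exists>c. r \<circ> S \<circ> r = (\<lambda>x. c *\<^sub>C r x) \<and> q \<circ> T \<circ> q = (\<lambda>x. c *\<^sub>C q x)"
      if "compact_operator S" "compact_operator T" for S T
      using minimal[OF that(2,1)] by blast
    ultimately obtain f where "norm f = 1" "r = rank_one f f"
      using minimal_projection_rank_one[OF r idem(2) self_adj(2) _ _ compact_operator_clinear[OF q]]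
      by blast
    then show ?thesis using that qr True by auto
  qed
qed

text \<open>
  The vectors of \<open>\<H>\<close> are the rank-one operators \<open>|x\<rangle>\<langle>e|\<close>, that is, the left ideal generated by
  the projection onto \<open>e\<close>. A Real structure that keeps this projection in the first summand
  maps the left ideal onto the one generated by the image projection, and \<open>J\<close> is the resulting
  map of vectors. Multiplicativity makes \<open>J\<close> intertwine the two actions on the left ideals,
  and \<open>J\<^sup>2\<close> is a scalar because it commutes with all rank-one operators.
\<close>

lemma Ad_of_summand_preserving:
  assumes "norm e = 1" "norm f = 1"
    and p: "\<tau> (rank_one e e, \<lambda>_. 0) = (rank_one f f, \<lambda>_. 0)"
  shows "\<exists>J. antiunitary J \<and> (J \<circ> J = id \<or> J \<circ> J = uminus) \<and>
    (\<forall>a b. compact_operator a \<longrightarrow> compact_operator b \<longrightarrow> \<tau> (a, b) = (Ad J a, Ad J b))"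
proof -
  let ?Z = "\<lambda>_::'h. 0::'h"
  note cpt = compact_operator_rank_one compact_operator_zero
  have e: "cinner e e = 1" and f: "cinner f f = 1" using assms by (simp_all add: cinner_self)
  define u where "u x = fst (\<tau> (rank_one x e, ?Z))" for x
  define J where "J x = u x f" for x
  have u: "\<tau> (rank_one x e, ?Z) = (u x, ?Z)" for x
  proof -
    obtain c d where cd: "\<tau> (rank_one x e, ?Z) = (c, d)" by fastforce
    have "rank_one x e \<circ> rank_one e e = rank_one x e" by (simp add: rank_one_comp_rank_one e)
    then have "\<tau> (rank_one x e, ?Z) = (c \<circ> rank_one f f, d \<circ> ?Z)"
      using mult[OF cpt cpt cd p] by (simp add: o_def)
    then have "d = d \<circ> ?Z" using cd by simp
    moreover have "clinear d"
      using compact(2)[OF cpt, of x e] cd by (simp add: compact_operator_clinear)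
    ultimately have "d = ?Z" by (auto simp: fun_eq_iff clinear_zero)
    then show ?thesis using cd by (simp add: u_def)
  qed
  have cpt_u: "compact_operator (u x)" for x
    using compact(1)[OF cpt] by (simp add: u_def)
  have "J e = f"
    using u[of e] p f by (simp add: J_def rank_one_def)
  have J_add: "J (x + y) = J x + J y" for x y
  proof -
    have "(\<lambda>z. rank_one x e z + rank_one y e z) = rank_one (x + y) e"
      by (simp add: rank_one_def scaleC_add_right)
    then show ?thesis
      using add[OF cpt cpt u[of x] u[of y]] u[of "x + y"] by (simp add: J_def)
  qed
  have J_scale: "J (c *\<^sub>C x) = cnj c *\<^sub>C J x" for c x
  proof -
    have "(\<lambda>z. c *\<^sub>C rank_one x e z) = rank_one (c *\<^sub>C x) e"
      by (simp add: rank_one_def scaleC_scaleC mult.commute)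
    then show ?thesis
      using scale[OF cpt u[of x], of c] u[of "c *\<^sub>C x"] by (simp add: J_def)
  qed
  have J_cinner: "cinner (J x) (J y) = cnj (cinner x y)" for x y
  proof -
    have Z: "cadjoint ?Z = ?Z" by (rule cadjoint_eqI) simp
    have "\<tau> (rank_one e x, ?Z) = (cadjoint (u x), ?Z)"
      using star[OF cpt u[of x]] by (simp add: cadjoint_rank_one Z)
    from mult[OF cpt cpt this u[of y]]
    have "\<tau> (rank_one e x \<circ> rank_one y e, ?Z) = (cadjoint (u x) \<circ> u y, ?Z)"
      by (simp add: o_def)
    moreover have "\<tau> (rank_one e x \<circ> rank_one y e, ?Z) = (\<lambda>z. cnj (cinner x y) *\<^sub>C rank_one f f z, ?Z)"
      using scale[OF cpt p, of "cinner x y"] by (simp add: rank_one_comp_rank_one)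
    ultimately have "cadjoint (u x) (u y f) = cnj (cinner x y) *\<^sub>C f"
      by (auto simp: fun_eq_iff rank_one_def f)
    then have "cinner f (cadjoint (u x) (u y f)) = cnj (cinner x y)"
      by (simp add: cinner_scaleC_right f)
    then show ?thesis by (simp add: J_def cinner_cadjoint_right[OF cpt_u])
  qed
  \<comment> \<open>Read off from \<open>(a, b) (|x\<rangle>\<langle>e|, 0) = (|a x\<rangle>\<langle>e|, 0)\<close>.\<close>
  have intertwine_fst: "a' (J x) = J (a x)"
    if "compact_operator a" "compact_operator b" "\<tau> (a, b) = (a', b')" for a b a' b' x
  proof -
    have "a \<circ> rank_one x e = rank_one (a x) e"
      using that(1) by (simp add: clinear_comp_rank_one compact_operator_clinear)
    moreover have "b \<circ> ?Z = ?Z"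
      using that(2) by (auto simp: clinear_zero compact_operator_clinear)
    ultimately have "u (a x) = a' \<circ> u x"
      using mult[OF that(1,2) cpt that(3) u[of x]] u[of "a x"] by simp
    then show ?thesis by (simp add: J_def)
  qed
  have "surj J"
  proof (rule surjI)
    fix z
    let ?T = "fst (\<tau> (rank_one z f, ?Z))"
    have "rank_one z f (J e) = J (?T e)"
      using intertwine_fst[OF compact[OF cpt, of z f], of "rank_one z f" ?Z e] involutive[OF cpt, of z f]
      by simp
    then show "J (fst (\<tau> (rank_one z f, ?Z)) e) = z"
      using \<open>J e = f\<close> f by (simp add: rank_one_def)
  qed
  then have J: "antiunitary J"
    using J_add J_scale J_cinner by (simp add: antiunitary_def)
  have Ad: "\<tau> (a, b) = (Ad J a, Ad J b)" if "compact_operator a" "compact_operator b" for a b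
  proof -
    obtain a' b' where ab: "\<tau> (a, b) = (a', b')" by fastforce
    note intertwine_fst[OF that ab]
    moreover note intertwine_fst[OF that(2,1) swap[OF that ab]]
    moreover have "J (inv J x) = x" for x using \<open>surj J\<close> by (rule surj_f_inv_f)
    ultimately have "a' x = Ad J a x" "b' x = Ad J b x" for x
      by (simp_all add: Ad_def) metis+
    then show ?thesis using ab by auto
  qed
  \<comment> \<open>Applying \<open>\<tau>\<close> twice shows that \<open>J\<^sup>2\<close> commutes with \<open>|x\<rangle>\<langle>e|\<close>; evaluation at \<open>e\<close> gives the scalar.\<close>
  define k where "k = cinner e (J (J e))"
  have JJ: "J (J x) = k *\<^sub>C x" for x
  proof -
    let ?a = "rank_one x e"
    obtain a' b' where ab: "\<tau> (?a, ?Z) = (a', b')" by fastforce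
    have "?a (J (J e)) = J (a' (J e))"
      using intertwine_fst[of a' b' ?a ?Z "J e"] compact[OF cpt, of x e] involutive[OF cpt, of x e] ab
      by simp
    also have "\<dots> = J (J (?a e))" using intertwine_fst[OF cpt ab] by simp
    finally show ?thesis by (simp add: rank_one_def e k_def)
  qed
  have "f \<noteq> 0" using assms(2) by auto
  \<comment> \<open>\<open>J\<close> commutes with \<open>J\<^sup>2 = k\<close> but conjugates scalars, so \<open>k\<close> is real.\<close>
  have "cnj k *\<^sub>C f = k *\<^sub>C f"
    using J_scale[of k e] JJ[of e] JJ[of "J e"] \<open>J e = f\<close> by simp
  then have "cnj k = k" using \<open>f \<noteq> 0\<close> by (rule complex_vector.scale_right_imp_eq[rotated])
  moreover have "k * cnj k = 1"
    using J_cinner[of "J e" "J e"] J_cinner[of e e] e JJ[of e]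
    by (simp add: cinner_scaleC_left cinner_scaleC_right)
  ultimately have "k = 1 \<or> k = - 1"
    by (simp add: square_eq_1_iff)
  then have "J \<circ> J = id \<or> J \<circ> J = uminus"
    by (auto simp: fun_eq_iff JJ)
  then show ?thesis using J Ad by blast
qed

end

text \<open>
  The flip is the grading, so a Real structure exchanging the summands becomes one preserving
  them after composition with the flip.
\<close>

theorem K_odd_real_structure_classification:
  fixes \<sigma> :: "('h::complex_hilbert_space \<Rightarrow> 'h) \<times> ('h \<Rightarrow> 'h) \<Rightarrow> ('h \<Rightarrow> 'h) \<times> ('h \<Rightarrow> 'h)"
  assumes "real_structure K_odd \<sigma>" and "\<exists>x :: 'h. x \<noteq> 0"
  shows "\<exists>J. antiunitary J \<and> (J \<circ> J = id \<or> J \<circ> J = uminus) \<and>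
    ((\<forall>a b. compact_operator a \<longrightarrow> compact_operator b \<longrightarrow> \<sigma> (a, b) = (Ad J a, Ad J b)) \<or>
     (\<forall>a b. compact_operator a \<longrightarrow> compact_operator b \<longrightarrow> \<sigma> (a, b) = (Ad J b, Ad J a)))"
proof -
  interpret \<sigma>: K_odd_real_structure \<sigma> by unfold_locales (rule assms)
  define \<tau> where "\<tau> = prod.swap \<circ> \<sigma>"
  have swap_hom:
    "prod.swap y \<in> gcarrier K_odd \<longleftrightarrow> y \<in> gcarrier K_odd"
    "gadd K_odd (prod.swap y) (prod.swap y') = prod.swap (gadd K_odd y y')"
    "gscale K_odd c (prod.swap y) = prod.swap (gscale K_odd c y)"
    "gmult K_odd (prod.swap y) (prod.swap y') = prod.swap (gmult K_odd y y')"
    "gstar K_odd (prod.swap y) = prod.swap (gstar K_odd y)"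
    "ggrade K_odd y = prod.swap y"
    for c and y y' :: "('h \<Rightarrow> 'h) \<times> ('h \<Rightarrow> 'h)"
    by (cases y; cases y'; auto simp: K_odd_simps)+
  then have "real_structure K_odd \<tau>"
    using assms(1) by (simp add: real_structure_def \<tau>_def)
  then interpret \<tau>: K_odd_real_structure \<tau> by unfold_locales
  obtain x :: 'h where "x \<noteq> 0" using assms(2) by blast
  define e where "e = (1 / norm x) *\<^sub>R x"
  have e: "norm e = 1" using \<open>x \<noteq> 0\<close> by (simp add: e_def)
  obtain f where f: "norm f = 1"
    "\<sigma> (rank_one e e, \<lambda>_. 0) = (rank_one f f, \<lambda>_. 0) \<or>
     \<sigma> (rank_one e e, \<lambda>_. 0) = (\<lambda>_. 0, rank_one f f)"
    using \<sigma>.image_of_minimal_projection[OF e] by metis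
  from f(2) show ?thesis
  proof
    assume "\<sigma> (rank_one e e, \<lambda>_. 0) = (rank_one f f, \<lambda>_. 0)"
    from \<sigma>.Ad_of_summand_preserving[OF e f(1) this] show ?thesis by blast
  next
    assume "\<sigma> (rank_one e e, \<lambda>_. 0) = (\<lambda>_. 0, rank_one f f)"
    then have "\<tau> (rank_one e e, \<lambda>_. 0) = (rank_one f f, \<lambda>_. 0)" by (simp add: \<tau>_def)
    from \<tau>.Ad_of_summand_preserving[OF e f(1) this]
    obtain J where J: "antiunitary J" "J \<circ> J = id \<or> J \<circ> J = uminus"
      "\<And>a b. compact_operator a \<Longrightarrow> compact_operator b \<Longrightarrow> \<tau> (a, b) = (Ad J a, Ad J b)"
      by blast
    have "\<sigma> (a, b) = (Ad J b, Ad J a)" if "compact_operator a" "compact_operator b" for a b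
    proof -
      have "\<sigma> (a, b) = prod.swap (\<tau> (a, b))" by (simp add: \<tau>_def)
      then show ?thesis using J(3)[OF that] by simp
    qed
    then show ?thesis using J(1,2) by blast
  qed
qed

section \<open>The free vector space and its coordinate operators\<close>

lemma lookup_fscale: "Poly_Mapping.lookup (fscale c f) p = c * Poly_Mapping.lookup f p"
  by (simp add: fscale_def Poly_Mapping.map.rep_eq when_def)

interpretation free: vector_space fscale
  by unfold_locales
    (simp_all add: poly_mapping_eq_iff fun_eq_iff lookup_fscale lookup_add algebra_simps)

lemma poly_mapping_expansion:
  "f = (\<Sum>p\<in>Poly_Mapping.keys f. fscale (Poly_Mapping.lookup f p) (gen (fst p) (snd p)))"
proof (rule poly_mapping_eqI)
  fix k
  have "(\<Sum>p\<in>Poly_Mapping.keys f. Poly_Mapping.lookup f p * (1 when p = k)) =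
      (\<Sum>p\<in>Poly_Mapping.keys f. if p = k then Poly_Mapping.lookup f p else 0)"
    by (intro sum.cong) (auto simp: when_def)
  then show "Poly_Mapping.lookup f k = Poly_Mapping.lookup
      (\<Sum>p\<in>Poly_Mapping.keys f. fscale (Poly_Mapping.lookup f p) (gen (fst p) (snd p))) k"
    by (simp add: lookup_sum lookup_fscale gen_def lookup_single in_keys_iff)
qed

lemma keys_gen: "Poly_Mapping.keys (gen a b) = {(a, b)}"
  by (simp add: gen_def)

lemma keys_fscale: "Poly_Mapping.keys (fscale c f) \<subseteq> Poly_Mapping.keys f"
  by (auto simp: in_keys_iff lookup_fscale)

lemma free_space_gen: "gen a b \<in> free_space A B \<longleftrightarrow> a \<in> gcarrier A \<and> b \<in> gcarrier B"
  by (simp add: free_space_def keys_gen)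

lemma free_space_add: "f \<in> free_space A B \<Longrightarrow> g \<in> free_space A B \<Longrightarrow> f + g \<in> free_space A B"
  unfolding free_space_def using Poly_Mapping.keys_add[of f g] by blast

lemma free_space_fscale: "f \<in> free_space A B \<Longrightarrow> fscale c f \<in> free_space A B"
  unfolding free_space_def using keys_fscale[of c f] by blast

lemma free_space_sum:
  "(\<And>i. i \<in> F \<Longrightarrow> h i \<in> free_space A B) \<Longrightarrow> (\<Sum>i\<in>F. h i) \<in> free_space A B"
  by (induction F rule: infinite_finite_induct) (auto intro: free_space_add, simp_all add: free_space_def)

lemma free_space_lin_ext:
  assumes "f \<in> free_space A B"
    and "\<And>a b. a \<in> gcarrier A \<Longrightarrow> b \<in> gcarrier B \<Longrightarrow> h (a, b) \<in> free_space C D"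
  shows "lin_ext h f \<in> free_space C D" "conj_lin_ext h f \<in> free_space C D"
  unfolding lin_ext_def conj_lin_ext_def
  using assms by (auto intro!: free_space_sum free_space_fscale simp: free_space_def[of A B])

text \<open>
  The two characters \<open>fst\<close> and \<open>snd\<close> of \<open>Cl1\<close> induce linear maps \<open>a \<otimes> b \<mapsto> w(b) a\<close>, written
  pointwise on vectors so that they are defined on the whole free space. They are the two
  components of the isomorphism from the tensor product to \<open>K \<oplus> K\<close>.
\<close>

definition coord ::
    "('b \<Rightarrow> complex) \<Rightarrow> (('h::complex_hilbert_space \<Rightarrow> 'h) \<times> 'b \<Rightarrow>\<^sub>0 complex) \<Rightarrow> 'h \<Rightarrow> 'h" where
  "coord w f x =
     (\<Sum>p\<in>Poly_Mapping.keys f. (Poly_Mapping.lookup f p * w (snd p)) *\<^sub>C fst p x)"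

lemma coord_superset:
  assumes "finite F" "Poly_Mapping.keys f \<subseteq> F"
  shows "coord w f x = (\<Sum>p\<in>F. (Poly_Mapping.lookup f p * w (snd p)) *\<^sub>C fst p x)"
  unfolding coord_def by (rule sum.mono_neutral_left) (use assms in \<open>auto simp: in_keys_iff\<close>)

lemma coord_add: "coord w (f + g) x = coord w f x + coord w g x"
proof -
  define F where "F = Poly_Mapping.keys f \<union> Poly_Mapping.keys g"
  have F: "finite F" "Poly_Mapping.keys f \<subseteq> F" "Poly_Mapping.keys g \<subseteq> F"
    "Poly_Mapping.keys (f + g) \<subseteq> F"
    using Poly_Mapping.keys_add[of f g] by (auto simp: F_def)
  show ?thesis
    unfolding coord_superset[OF F(1,2)] coord_superset[OF F(1,3)] coord_superset[OF F(1,4)]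
    by (simp add: lookup_add ring_distribs scaleC_add_left sum.distrib)
qed

lemma coord_fscale: "coord w (fscale c f) x = c *\<^sub>C coord w f x"
  unfolding coord_superset[OF finite_keys keys_fscale]
  by (simp add: coord_def lookup_fscale complex_vector.scale_sum_right scaleC_scaleC mult.assoc)

lemma coord_diff: "coord w (f - g) x = coord w f x - coord w g x"
  using coord_add[of w "f - g" g x] by simp

lemma coord_zero: "coord w 0 x = 0"
  by (simp add: coord_def)

lemma coord_sum: "coord w (\<Sum>i\<in>F. h i) x = (\<Sum>i\<in>F. coord w (h i) x)"
  by (induction F rule: infinite_finite_induct) (simp_all add: coord_zero coord_add)

lemma coord_gen: "coord w (gen a b) x = w b *\<^sub>C a x"
  by (simp add: coord_def keys_gen) (simp add: gen_def)

lemma coord_lin_ext: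
  "coord w (lin_ext h f) x =
     (\<Sum>p\<in>Poly_Mapping.keys f. Poly_Mapping.lookup f p *\<^sub>C coord w (h p) x)"
  "coord w (conj_lin_ext h f) x =
     (\<Sum>p\<in>Poly_Mapping.keys f. cnj (Poly_Mapping.lookup f p) *\<^sub>C coord w (h p) x)"
  by (simp_all add: lin_ext_def conj_lin_ext_def coord_sum coord_fscale)

section \<open>The tensor product with \<open>Cl1\<close> as a direct sum\<close>

abbreviation KCl :: "(('h::complex_hilbert_space \<Rightarrow> 'h) \<times> complex \<times> complex \<Rightarrow>\<^sub>0 complex) set" where
  "KCl \<equiv> free_space compact_operators Cl1"

lemma Cl1_simps:
  "gcarrier Cl1 = UNIV"
  "gadd Cl1 b b' = (fst b + fst b', snd b + snd b')"
  "gscale Cl1 c b = (c * fst b, c * snd b)"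
  "gmult Cl1 b b' = (fst b * fst b', snd b * snd b')"
  "gstar Cl1 b = (cnj (fst b), cnj (snd b))"
  "ggrade Cl1 b = (snd b, fst b)"
  by (simp_all add: Cl1_def flip_sum_def complex_numbers_def split_beta)

lemma compact_operator_coord:
  assumes "f \<in> KCl"
  shows "compact_operator (coord w f)"
  unfolding coord_def
  using assms
  by (intro compact_operator_sum compact_operator_scaleC)
    (auto simp: free_space_def compact_operators_simps)

lemma coord_span_relators:
  assumes "w \<in> {fst, snd}"
    and "f \<in> module.span fscale (bilinearity_relators compact_operators Cl1)"
  shows "coord w f x = 0"
  using assms(2)
proof (rule free.span_induct)
  show "free.subspace {f. coord w f x = 0}"
    by (simp add: free.subspace_def coord_zero coord_add coord_fscale)
  show "coord w r x = 0" if "r \<in> bilinearity_relators compact_operators Cl1" for r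
    using that assms(1) unfolding bilinearity_relators_def
    by (auto simp: coord_diff coord_gen coord_fscale compact_operators_simps Cl1_simps
        scaleC_add_left scaleC_add_right scaleC_scaleC mult.commute)
qed

definition tensor_cong ::
    "(('h::complex_hilbert_space \<Rightarrow> 'h) \<times> complex \<times> complex \<Rightarrow>\<^sub>0 complex) \<Rightarrow>
     (('h \<Rightarrow> 'h) \<times> complex \<times> complex \<Rightarrow>\<^sub>0 complex) \<Rightarrow> bool"  (infix \<open>\<simeq>\<close> 50) where
  "f \<simeq> g \<longleftrightarrow> f - g \<in> module.span fscale (bilinearity_relators compact_operators Cl1)"

lemma tensor_cong_refl: "f \<simeq> f"
  by (simp add: tensor_cong_def free.span_zero)

lemma tensor_cong_sym: "f \<simeq> g \<Longrightarrow> g \<simeq> f"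
  unfolding tensor_cong_def using free.span_neg by fastforce

lemma tensor_cong_trans [trans]: "f \<simeq> g \<Longrightarrow> g \<simeq> h \<Longrightarrow> f \<simeq> h"
  unfolding tensor_cong_def using free.span_add by fastforce

lemma tensor_cong_add: "f \<simeq> f' \<Longrightarrow> g \<simeq> g' \<Longrightarrow> f + g \<simeq> f' + g'"
  unfolding tensor_cong_def using free.span_add by (metis add_diff_add)

lemma tensor_cong_fscale: "f \<simeq> g \<Longrightarrow> fscale c f \<simeq> fscale c g"
  unfolding tensor_cong_def using free.span_scale by (metis free.scale_right_diff_distrib)

lemma tensor_cong_sum: "(\<And>i. i \<in> F \<Longrightarrow> f i \<simeq> g i) \<Longrightarrow> (\<Sum>i\<in>F. f i) \<simeq> (\<Sum>i\<in>F. g i)"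
  by (induction F rule: infinite_finite_induct) (simp_all add: tensor_cong_refl tensor_cong_add)

lemma bilinearity_relatorsI:
  assumes "a \<in> gcarrier A" "b \<in> gcarrier B"
  shows "a' \<in> gcarrier A \<Longrightarrow> gen (gadd A a a') b - gen a b - gen a' b \<in> bilinearity_relators A B"
    and "b' \<in> gcarrier B \<Longrightarrow> gen a (gadd B b b') - gen a b - gen a b' \<in> bilinearity_relators A B"
    and "gen (gscale A c a) b - fscale c (gen a b) \<in> bilinearity_relators A B"
    and "gen a (gscale B c b) - fscale c (gen a b) \<in> bilinearity_relators A B"
  unfolding bilinearity_relators_def using assms by blast+

lemma gen_add_left:
  assumes "compact_operator a" "compact_operator a'"
  shows "gen (\<lambda>x. a x + a' x) b \<simeq> gen a b + gen a' b"
proof -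
  have "gen (gadd compact_operators a a') b - gen a b - gen a' b
      \<in> bilinearity_relators compact_operators Cl1"
    using assms by (intro bilinearity_relatorsI) (simp_all add: compact_operators_simps(1) Cl1_simps(1))
  then show ?thesis
    unfolding tensor_cong_def compact_operators_simps diff_diff_eq by (rule free.span_base)
qed

lemma gen_add_right:
  assumes "compact_operator a"
  shows "gen a (b + b') \<simeq> gen a b + gen a b'"
proof -
  have "gen a (gadd Cl1 b b') - gen a b - gen a b' \<in> bilinearity_relators compact_operators Cl1"
    using assms by (intro bilinearity_relatorsI) (simp_all add: compact_operators_simps(1) Cl1_simps(1))
  moreover have "gadd Cl1 b b' = b + b'" by (simp add: Cl1_simps prod_eq_iff)
  ultimately show ?thesis
    unfolding tensor_cong_def diff_diff_eq by (simp add: free.span_base)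
qed

lemma gen_scale_left:
  assumes "compact_operator a"
  shows "gen (\<lambda>x. c *\<^sub>C a x) b \<simeq> fscale c (gen a b)"
proof -
  have "gen (gscale compact_operators c a) b - fscale c (gen a b)
      \<in> bilinearity_relators compact_operators Cl1"
    using assms by (intro bilinearity_relatorsI) (simp_all add: compact_operators_simps(1) Cl1_simps(1))
  then show ?thesis
    unfolding tensor_cong_def compact_operators_simps by (rule free.span_base)
qed

lemma gen_scale_right:
  assumes "compact_operator a"
  shows "gen a (c * fst b, c * snd b) \<simeq> fscale c (gen a b)"
proof -
  have "gen a (gscale Cl1 c b) - fscale c (gen a b) \<in> bilinearity_relators compact_operators Cl1"
    using assms by (intro bilinearity_relatorsI) (simp_all add: compact_operators_simps(1) Cl1_simps(1))
  then show ?thesis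
    unfolding tensor_cong_def Cl1_simps by (rule free.span_base)
qed

lemma gen_sum_left:
  assumes "\<And>p. p \<in> F \<Longrightarrow> compact_operator (T p)" "finite F"
  shows "gen (\<lambda>x. \<Sum>p\<in>F. c p *\<^sub>C T p x) b \<simeq> (\<Sum>p\<in>F. fscale (c p) (gen (T p) b))"
  using assms(2,1)
proof (induction F)
  case empty
  show ?case using gen_scale_left[OF compact_operator_zero, of 0 b] by simp
next
  case (insert p F)
  have "gen (\<lambda>x. c p *\<^sub>C T p x + (\<Sum>p\<in>F. c p *\<^sub>C T p x)) b
      \<simeq> gen (\<lambda>x. c p *\<^sub>C T p x) b + gen (\<lambda>x. \<Sum>p\<in>F. c p *\<^sub>C T p x) b"
    using insert.prems
    by (intro gen_add_left compact_operator_sum compact_operator_scaleC) auto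
  also have "\<dots> \<simeq> fscale (c p) (gen (T p) b) + (\<Sum>p\<in>F. fscale (c p) (gen (T p) b))"
    using insert by (intro tensor_cong_add gen_scale_left) auto
  finally show ?case using insert.hyps by simp
qed

lemma gen_split:
  assumes "compact_operator a"
  shows "gen a b \<simeq> fscale (fst b) (gen a (1, 0)) + fscale (snd b) (gen a (0, 1))"
proof -
  have "gen a ((fst b, 0) + (0, snd b)) \<simeq> gen a (fst b, 0) + gen a (0, snd b)"
    by (rule gen_add_right[OF assms])
  also have "\<dots> \<simeq> fscale (fst b) (gen a (1, 0)) + fscale (snd b) (gen a (0, 1))"
    using gen_scale_right[OF assms, of "fst b" "(1, 0)"] gen_scale_right[OF assms, of "snd b" "(0, 1)"]
    by (intro tensor_cong_add) simp_all
  finally show ?thesis by simp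
qed

definition tensor_normal ::
    "('h::complex_hilbert_space \<Rightarrow> 'h) \<Rightarrow> ('h \<Rightarrow> 'h) \<Rightarrow> (('h \<Rightarrow> 'h) \<times> complex \<times> complex \<Rightarrow>\<^sub>0 complex)" where
  "tensor_normal a b = gen a (1, 0) + gen b (0, 1)"

lemma coord_tensor_normal:
  "coord fst (tensor_normal a b) = a" "coord snd (tensor_normal a b) = b"
  by (auto simp: tensor_normal_def coord_add coord_gen)

text \<open>
  \<open>(1, 0)\<close> and \<open>(0, 1)\<close> form a basis of \<open>Cl1\<close>, so every tensor is congruent to one with these
  right factors; its left factors are the coordinates. Hence the coordinates separate the
  classes.
\<close>

lemma tensor_cong_normal:
  assumes "f \<in> KCl"
  shows "f \<simeq> tensor_normal (coord fst f) (coord snd f)"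
proof -
  let ?K = "Poly_Mapping.keys f" and ?c = "Poly_Mapping.lookup f"
  have cpt: "compact_operator (fst p)" if "p \<in> ?K" for p
    using assms that by (auto simp: free_space_def compact_operators_simps)
  have left: "(\<Sum>p\<in>?K. fscale (?c p * w (snd p)) (gen (fst p) b)) \<simeq> gen (coord w f) b" for w b
  proof -
    have "coord w f = (\<lambda>x. \<Sum>p\<in>?K. (?c p * w (snd p)) *\<^sub>C fst p x)"
      by (simp add: coord_def fun_eq_iff)
    then show ?thesis
      using cpt gen_sum_left[of ?K fst "\<lambda>p. ?c p * w (snd p)" b] by (simp add: tensor_cong_sym)
  qed
  have "(\<Sum>p\<in>?K. fscale (?c p) (gen (fst p) (snd p))) \<simeq>
      (\<Sum>p\<in>?K. fscale (?c p) (fscale (fst (snd p)) (gen (fst p) (1, 0)) + fscale (snd (snd p)) (gen (fst p) (0, 1))))"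
    by (intro tensor_cong_sum tensor_cong_fscale gen_split cpt)
  also have "\<dots> = (\<Sum>p\<in>?K. fscale (?c p * fst (snd p)) (gen (fst p) (1, 0))) +
      (\<Sum>p\<in>?K. fscale (?c p * snd (snd p)) (gen (fst p) (0, 1)))"
    by (simp add: free.scale_right_distrib sum.distrib)
  also have "\<dots> \<simeq> tensor_normal (coord fst f) (coord snd f)"
    unfolding tensor_normal_def by (intro tensor_cong_add left)
  finally show ?thesis by (simp flip: poly_mapping_expansion)
qed

lemma tensor_rel_iff:
  "(f, g) \<in> tensor_rel compact_operators Cl1 \<longleftrightarrow>
     f \<in> KCl \<and> g \<in> KCl \<and> coord fst f = coord fst g \<and> coord snd f = coord snd g"
proof -
  have "f \<simeq> g" if "f \<in> KCl" "g \<in> KCl" "coord fst f = coord fst g" "coord snd f = coord snd g"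
    using tensor_cong_trans[OF tensor_cong_normal[OF that(1)]] tensor_cong_sym[OF tensor_cong_normal[OF that(2)]]
    by (simp add: that(3,4))
  moreover have "coord w f = coord w g" if "f \<simeq> g" "w \<in> {fst, snd}" for w
    using coord_span_relators[OF that(2)] that(1) by (fastforce simp: tensor_cong_def coord_diff)
  ultimately show ?thesis by (auto simp: tensor_rel_def simp flip: tensor_cong_def)
qed

text \<open>
  The isomorphism from \<open>K \<oplus> K\<close> to the tensor product, \<open>(a, b) \<mapsto> a \<otimes> (1, 0) + b \<otimes> (0, 1)\<close>. Its value
  is a whole class of representatives, described here by their coordinates.
\<close>

definition tensor_class ::
    "('h::complex_hilbert_space \<Rightarrow> 'h) \<times> ('h \<Rightarrow> 'h) \<Rightarrow> (('h \<Rightarrow> 'h) \<times> complex \<times> complex \<Rightarrow>\<^sub>0 complex) set" where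
  "tensor_class y = {f \<in> KCl. (coord fst f, coord snd f) = y}"

lemma tensor_rel_Image:
  "g \<in> KCl \<Longrightarrow> tensor_rel compact_operators Cl1 `` {g} = tensor_class (coord fst g, coord snd g)"
  by (auto simp: tensor_class_def tensor_rel_iff)

lemma tensor_normal_in_class:
  "y \<in> gcarrier K_odd \<Longrightarrow> tensor_normal (fst y) (snd y) \<in> tensor_class y"
  by (cases y) (simp add: tensor_class_def coord_tensor_normal, auto simp: K_odd_simps
      tensor_normal_def free_space_gen compact_operators_simps Cl1_simps intro!: free_space_add)

lemma bij_betw_tensor_class:
  "bij_betw tensor_class (gcarrier K_odd) (gcarrier (compact_operators \<otimes>\<^sub>g Cl1))"
  (is "bij_betw ?c ?K ?T")
proof (rule bij_betw_imageI)
  show "inj_on ?c ?K"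
  proof (rule inj_onI)
    fix y y' :: "('a \<Rightarrow> 'a) \<times> ('a \<Rightarrow> 'a)"
    assume "y \<in> gcarrier K_odd" "tensor_class y = tensor_class y'"
    then have "tensor_normal (fst y) (snd y) \<in> tensor_class y'"
      using tensor_normal_in_class by blast
    then show "y = y'" by (simp add: tensor_class_def coord_tensor_normal prod_eq_iff)
  qed
  show "?c ` ?K = ?T"
  proof (intro equalityI subsetI)
    fix X :: "(('a \<Rightarrow> 'a) \<times> complex \<times> complex \<Rightarrow>\<^sub>0 complex) set"
    assume "X \<in> tensor_class ` gcarrier K_odd"
    then obtain y where y: "y \<in> gcarrier K_odd" "X = tensor_class y" by blast
    let ?n = "tensor_normal (fst y) (snd y)"
    have "?n \<in> KCl" using tensor_normal_in_class[OF y(1)] by (simp add: tensor_class_def)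
    moreover have "X = tensor_rel compact_operators Cl1 `` {?n}"
      using tensor_rel_Image[OF \<open>?n \<in> KCl\<close>] y by (simp add: coord_tensor_normal)
    ultimately show "X \<in> gcarrier (compact_operators \<otimes>\<^sub>g Cl1)"
      by (auto simp: graded_tensor_def intro: quotientI)
  next
    fix X :: "(('a \<Rightarrow> 'a) \<times> complex \<times> complex \<Rightarrow>\<^sub>0 complex) set"
    assume "X \<in> gcarrier (compact_operators \<otimes>\<^sub>g Cl1)"
    then obtain f where "f \<in> KCl" "X = tensor_rel compact_operators Cl1 `` {f}"
      by (auto simp: graded_tensor_def elim: quotientE)
    then show "X \<in> tensor_class ` gcarrier K_odd"
      by (auto simp: tensor_rel_Image K_odd_simps compact_operator_coord)
  qed
qed

text \<open>
  An operation on the tensor product is computed on representatives; if the coordinates of the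
  result depend only on those of the argument, its value on a class is again a class.
\<close>

lemma tensor_class_lift:
  assumes "y \<in> gcarrier K_odd"
    and "\<And>f. f \<in> KCl \<Longrightarrow> (coord fst f, coord snd f) = y \<Longrightarrow>
      h f \<in> KCl \<and> (coord fst (h f), coord snd (h f)) = z"
  shows "(\<Union>f\<in>tensor_class y. tensor_rel compact_operators Cl1 `` {h f}) = tensor_class z"
proof -
  have "tensor_rel compact_operators Cl1 `` {h f} = tensor_class z" if "f \<in> tensor_class y" for f
    using assms(2)[of f] that by (simp add: tensor_class_def[of y] tensor_rel_Image)
  then show ?thesis using tensor_normal_in_class[OF assms(1)] by auto
qed

lemma tensor_class_lift2:
  assumes "y \<in> gcarrier K_odd" "y' \<in> gcarrier K_odd"
    and "\<And>f g. f \<in> KCl \<Longrightarrow> (coord fst f, coord snd f) = y \<Longrightarrow> g \<in> KCl \<Longrightarrow>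
      (coord fst g, coord snd g) = y' \<Longrightarrow> h f g \<in> KCl \<and> (coord fst (h f g), coord snd (h f g)) = z"
  shows "(\<Union>f\<in>tensor_class y. \<Union>g\<in>tensor_class y'. tensor_rel compact_operators Cl1 `` {h f g}) =
    tensor_class z"
proof -
  have "(\<Union>g\<in>tensor_class y'. tensor_rel compact_operators Cl1 `` {h f g}) = tensor_class z"
    if "f \<in> tensor_class y" for f
    using that by (intro tensor_class_lift assms(2,3)) (auto simp: tensor_class_def)
  then show ?thesis using tensor_normal_in_class[OF assms(1)] by auto
qed

subsection \<open>The graded product and involution in coordinates\<close>

lemma hom_part_compact:
  "hom_part compact_operators 0 a = a"
  "hom_part compact_operators (Suc 0) a = (\<lambda>x. 0)"
  by (simp_all add: hom_part_def compact_operators_simps fun_eq_iff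
      flip: scaleC_add_left complex_vector.scale_minus_left)
     (simp_all add: scaleC_add_right flip: scaleC_add_left)

lemma hom_part_Cl1:
  "w \<in> {fst, snd} \<Longrightarrow> w (hom_part Cl1 0 b) + w (hom_part Cl1 (Suc 0) b) = w b"
  by (auto simp: hom_part_def Cl1_simps field_simps)

lemma sum_below_2: "(\<Sum>i<2. h i) = h 0 + h (Suc 0)"
  by (simp add: numeral_2_eq_2)

text \<open>
  Compact operators are all even, so only the terms of degree 0 in the first factor survive and
  the signs disappear; the homogeneous parts in \<open>Cl1\<close> add up to the given element.
\<close>

lemma coord_gen_mult:
  assumes "w \<in> {fst, snd}" "clinear a"
  shows "coord w (gen_mult compact_operators Cl1 (a, b) (a', b')) x = (w b * w b') *\<^sub>C a (a' x)"
proof -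
  have w: "w (gmult Cl1 b b') = w b * w b'" for b b'
    using assms(1) by (auto simp: Cl1_simps)
  have "coord w (gen_mult compact_operators Cl1 (a, b) (a', b')) x =
      (w (hom_part Cl1 0 b) * w b') *\<^sub>C a (a' x) + (w (hom_part Cl1 (Suc 0) b) * w b') *\<^sub>C a (a' x)"
    using clinear_zero[OF assms(2)]
    by (simp add: gen_mult_def sum_below_2 coord_add coord_diff coord_fscale coord_gen hom_part_compact
        compact_operators_simps w)
  also have "\<dots> = (w b * w b') *\<^sub>C a (a' x)"
    unfolding scaleC_add_left[symmetric] distrib_right[symmetric] hom_part_Cl1[OF assms(1)] ..
  finally show ?thesis .
qed

lemma coord_gen_star:
  assumes "w \<in> {fst, snd}"
  shows "coord w (gen_star compact_operators Cl1 (a, b)) x = cnj (w b) *\<^sub>C cadjoint a x"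
proof -
  have w: "w (gstar Cl1 b) = cnj (w b)" for b
    using assms by (auto simp: Cl1_simps)
  have zero: "cadjoint (\<lambda>_::'a. 0::'a) = (\<lambda>_. 0)" by (rule cadjoint_eqI) simp
  have "coord w (gen_star compact_operators Cl1 (a, b)) x =
      cnj (w (hom_part Cl1 0 b)) *\<^sub>C cadjoint a x + cnj (w (hom_part Cl1 (Suc 0) b)) *\<^sub>C cadjoint a x"
    by (simp add: gen_star_def sum_below_2 coord_add coord_diff coord_fscale coord_gen hom_part_compact
        compact_operators_simps w zero)
  also have "\<dots> = cnj (w b) *\<^sub>C cadjoint a x"
    unfolding scaleC_add_left[symmetric] complex_cnj_add[symmetric] hom_part_Cl1[OF assms] ..
  finally show ?thesis .
qed

lemma free_space_gen_mult:
  assumes "compact_operator a" "compact_operator a'"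
  shows "gen_mult compact_operators Cl1 (a, b) (a', b') \<in> KCl"
  unfolding gen_mult_def prod.case sum_below_2 hom_part_compact
  by (intro free_space_add free_space_fscale)
    (simp_all add: free_space_gen compact_operators_simps Cl1_simps assms compact_operator_comp compact_operator_zero
      clinear_zero[OF compact_operator_clinear[OF assms(1)]])

lemma free_space_gen_star:
  assumes "compact_operator a"
  shows "gen_star compact_operators Cl1 (a, b) \<in> KCl"
  unfolding gen_star_def prod.case sum_below_2 hom_part_compact
  by (intro free_space_add free_space_fscale)
    (simp_all add: free_space_gen compact_operators_simps Cl1_simps assms compact_operator_cadjoint compact_operator_zero)

lemma coord_mult:
  assumes "w \<in> {fst, snd}" "f \<in> KCl" "g \<in> KCl"
  shows "coord w (lin_ext (\<lambda>p. lin_ext (gen_mult compact_operators Cl1 p) g) f) = coord w f \<circ> coord w g"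
proof
  fix x
  let ?c = "Poly_Mapping.lookup f" and ?d = "Poly_Mapping.lookup g"
  have "coord w (lin_ext (gen_mult compact_operators Cl1 p) g) x = w (snd p) *\<^sub>C fst p (coord w g x)"
    if "p \<in> Poly_Mapping.keys f" for p
  proof -
    have lin: "clinear (fst p)"
      using assms(2) that by (auto simp: free_space_def compact_operators_simps compact_operator_clinear)
    have "coord w (gen_mult compact_operators Cl1 p q) x = (w (snd p) * w (snd q)) *\<^sub>C fst p (fst q x)" for q
      using coord_gen_mult[OF assms(1) lin, of "snd p" "fst q" "snd q"] by simp
    then have "coord w (lin_ext (gen_mult compact_operators Cl1 p) g) x =
        (\<Sum>q\<in>Poly_Mapping.keys g. ?d q *\<^sub>C (w (snd p) * w (snd q)) *\<^sub>C fst p (fst q x))"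
      by (simp add: coord_lin_ext)
    also have "\<dots> = w (snd p) *\<^sub>C fst p (coord w g x)"
      using lin by (simp add: coord_def clinear_sum[OF lin] complex_vector.scale_sum_right
          clinear_iff scaleC_scaleC ac_simps)
    finally show ?thesis .
  qed
  then show "coord w (lin_ext (\<lambda>p. lin_ext (gen_mult compact_operators Cl1 p) g) f) x =
      (coord w f \<circ> coord w g) x"
    by (simp add: coord_lin_ext scaleC_scaleC) (simp add: coord_def)
qed

text \<open>
  Both sides are additive over the representation of \<open>f\<close>, but the right side is an adjoint of
  a sum; uniqueness of adjoints replaces a proof that taking adjoints is conjugate-linear.
\<close>

lemma coord_star:
  assumes "w \<in> {fst, snd}" "f \<in> KCl"
  shows "coord w (conj_lin_ext (gen_star compact_operators Cl1) f) = cadjoint (coord w f)"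
proof (rule cadjoint_eqI[symmetric])
  fix x y
  let ?c = "Poly_Mapping.lookup f"
  have "coord w (conj_lin_ext (gen_star compact_operators Cl1) f) x =
      (\<Sum>p\<in>Poly_Mapping.keys f. cnj (?c p * w (snd p)) *\<^sub>C cadjoint (fst p) x)"
    using coord_gen_star[OF assms(1), of "fst p" "snd p" x for p]
    by (simp add: coord_lin_ext scaleC_scaleC)
  moreover have "compact_operator (fst p)" if "p \<in> Poly_Mapping.keys f" for p
    using assms(2) that by (auto simp: free_space_def compact_operators_simps)
  ultimately show "cinner (coord w (conj_lin_ext (gen_star compact_operators Cl1) f) x) y =
      cinner x (coord w f y)"
    by (simp add: coord_def cinner_sum_left cinner_sum_right cinner_scaleC_left
        cinner_scaleC_right cinner_cadjoint)
qed

lemma tensor_class_hom: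
  fixes y y' :: "('h::complex_hilbert_space \<Rightarrow> 'h) \<times> ('h \<Rightarrow> 'h)"
  assumes "y \<in> gcarrier K_odd"
  shows "y' \<in> gcarrier K_odd \<Longrightarrow> tensor_class (gadd K_odd y y') =
      gadd (compact_operators \<otimes>\<^sub>g Cl1) (tensor_class y) (tensor_class y')"
    and "tensor_class (gscale K_odd c y) = gscale (compact_operators \<otimes>\<^sub>g Cl1) c (tensor_class y)"
    and "y' \<in> gcarrier K_odd \<Longrightarrow> tensor_class (gmult K_odd y y') =
      gmult (compact_operators \<otimes>\<^sub>g Cl1) (tensor_class y) (tensor_class y')"
    and "tensor_class (gstar K_odd y) = gstar (compact_operators \<otimes>\<^sub>g Cl1) (tensor_class y)"
    and "tensor_class (ggrade K_odd y) = ggrade (compact_operators \<otimes>\<^sub>g Cl1) (tensor_class y)"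
proof -
  assume y': "y' \<in> gcarrier K_odd"
  show "tensor_class (gadd K_odd y y') =
      gadd (compact_operators \<otimes>\<^sub>g Cl1) (tensor_class y) (tensor_class y')"
    unfolding graded_tensor_def graded_star_algebra.simps
    by (rule sym, rule tensor_class_lift2[OF assms y'])
      (auto simp: K_odd_simps free_space_add coord_add fun_eq_iff)
  show "tensor_class (gmult K_odd y y') =
      gmult (compact_operators \<otimes>\<^sub>g Cl1) (tensor_class y) (tensor_class y')"
    unfolding graded_tensor_def graded_star_algebra.simps
  proof (rule sym, rule tensor_class_lift2[OF assms y'], intro conjI)
    fix f g :: "('h \<Rightarrow> 'h) \<times> complex \<times> complex \<Rightarrow>\<^sub>0 complex"
    assume *: "f \<in> KCl" "(coord fst f, coord snd f) = y" "g \<in> KCl" "(coord fst g, coord snd g) = y'"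
    let ?h = "lin_ext (\<lambda>p. lin_ext (gen_mult compact_operators Cl1 p) g) f"
    show "?h \<in> KCl"
      by (intro free_space_lin_ext[OF *(1)] free_space_lin_ext[OF *(3)] free_space_gen_mult)
        (auto simp: compact_operators_simps)
    show "(coord fst ?h, coord snd ?h) = gmult K_odd y y'"
      using * by (auto simp: K_odd_simps coord_mult)
  qed
next
  show "tensor_class (gscale K_odd c y) = gscale (compact_operators \<otimes>\<^sub>g Cl1) c (tensor_class y)"
    unfolding graded_tensor_def graded_star_algebra.simps
    by (rule sym, rule tensor_class_lift[OF assms])
      (auto simp: K_odd_simps free_space_fscale coord_fscale fun_eq_iff)
  show "tensor_class (gstar K_odd y) = gstar (compact_operators \<otimes>\<^sub>g Cl1) (tensor_class y)"
    unfolding graded_tensor_def graded_star_algebra.simps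
  proof (rule sym, rule tensor_class_lift[OF assms], intro conjI)
    fix f :: "('h \<Rightarrow> 'h) \<times> complex \<times> complex \<Rightarrow>\<^sub>0 complex"
    assume *: "f \<in> KCl" "(coord fst f, coord snd f) = y"
    let ?h = "conj_lin_ext (gen_star compact_operators Cl1) f"
    show "?h \<in> KCl"
      by (intro free_space_lin_ext[OF *(1)] free_space_gen_star) (simp add: compact_operators_simps)
    show "(coord fst ?h, coord snd ?h) = gstar K_odd y"
      using * by (auto simp: K_odd_simps coord_star)
  qed
  show "tensor_class (ggrade K_odd y) = ggrade (compact_operators \<otimes>\<^sub>g Cl1) (tensor_class y)"
    unfolding graded_tensor_def graded_star_algebra.simps
  proof (rule sym, rule tensor_class_lift[OF assms], intro conjI)
    fix f :: "('h \<Rightarrow> 'h) \<times> complex \<times> complex \<Rightarrow>\<^sub>0 complex"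
    assume *: "f \<in> KCl" "(coord fst f, coord snd f) = y"
    let ?h = "lin_ext (\<lambda>(a, b). gen (ggrade compact_operators a) (ggrade Cl1 b)) f"
    show "?h \<in> KCl"
      by (intro free_space_lin_ext[OF *(1)]) (simp add: free_space_gen compact_operators_simps Cl1_simps)
    have "coord fst ?h = coord snd f" "coord snd ?h = coord fst f"
      by (simp_all add: fun_eq_iff coord_lin_ext split_beta coord_gen compact_operators_simps Cl1_simps scaleC_scaleC)
        (simp_all add: coord_def)
    then show "(coord fst ?h, coord snd ?h) = ggrade K_odd y"
      using * by (auto simp: K_odd_simps)
  qed
qed

subsection \<open>Real structures in coordinates\<close>

lemma coord_tensor_conj:
  assumes "antiunitary J" and w: "\<And>b. w (\<tau> b) = cnj (w' b)"
  shows "coord w (conj_lin_ext (\<lambda>(a, b). gen (Ad J a) (\<tau> b)) f) = Ad J (coord w' f)"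
proof
  fix x
  have J: "J (x + y) = J x + J y" "J (c *\<^sub>C x) = cnj c *\<^sub>C J x" for x y c
    using assms(1) by (auto simp: antiunitary_def)
  have "J 0 = 0" using J(1)[of 0 0] by simp
  have J_sum: "J (\<Sum>i\<in>F. h i) = (\<Sum>i\<in>F. J (h i))"
    for F :: "(('a \<Rightarrow> 'a) \<times> 'b) set" and h
    by (induction F rule: infinite_finite_induct) (simp_all add: \<open>J 0 = 0\<close> J)
  show "coord w (conj_lin_ext (\<lambda>(a, b). gen (Ad J a) (\<tau> b)) f) x = Ad J (coord w' f) x"
    by (simp add: coord_lin_ext split_beta coord_gen w Ad_def scaleC_scaleC)
      (simp add: coord_def J_sum J)
qed

text \<open>
  \<open>cl01\<close> conjugates each component of \<open>Cl1\<close>, while \<open>cl10\<close> also exchanges them. The characters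
  \<open>w\<close> and \<open>w'\<close> record which component of the argument feeds which component of the value, so
  that both cases are covered.
\<close>

lemma real_graded_isomorphic_tensorI:
  fixes \<sigma> :: "('h::complex_hilbert_space \<Rightarrow> 'h) \<times> ('h \<Rightarrow> 'h) \<Rightarrow> ('h \<Rightarrow> 'h) \<times> ('h \<Rightarrow> 'h)"
  assumes J: "antiunitary J"
    and Ad_compact: "\<And>a. compact_operator a \<Longrightarrow> compact_operator (Ad J a)"
    and \<tau>: "\<And>b. fst (\<tau> b) = cnj (w b)" "\<And>b. snd (\<tau> b) = cnj (w' b)"
    and \<sigma>: "\<And>f. f \<in> KCl \<Longrightarrow> \<sigma> (coord fst f, coord snd f) = (Ad J (coord w f), Ad J (coord w' f))"
  shows "real_graded_isomorphic (K_odd, \<sigma>)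
    (compact_operators \<otimes>\<^sub>g Cl1, tensor_conj_map compact_operators Cl1 (Ad J) \<tau>)"
proof -
  have "tensor_class (\<sigma> y) = tensor_conj_map compact_operators Cl1 (Ad J) \<tau> (tensor_class y)"
    if "y \<in> gcarrier K_odd" for y
    unfolding tensor_conj_map_def
  proof (rule sym, rule tensor_class_lift[OF that], intro conjI)
    fix f :: "('h \<Rightarrow> 'h) \<times> complex \<times> complex \<Rightarrow>\<^sub>0 complex"
    assume *: "f \<in> KCl" "(coord fst f, coord snd f) = y"
    let ?h = "conj_lin_ext (\<lambda>(a, b). gen (Ad J a) (\<tau> b)) f"
    show "?h \<in> KCl"
      by (intro free_space_lin_ext[OF *(1)])
        (simp add: free_space_gen compact_operators_simps Cl1_simps Ad_compact)
    show "(coord fst ?h, coord snd ?h) = \<sigma> y"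
      using coord_tensor_conj[of J fst \<tau> w, OF J \<tau>(1)] coord_tensor_conj[of J snd \<tau> w', OF J \<tau>(2)] \<sigma>[OF *(1)] *(2) by auto
  qed
  then show ?thesis
    unfolding real_graded_isomorphic.simps
    by (intro exI[of _ tensor_class]) (simp add: bij_betw_tensor_class tensor_class_hom)
qed

section \<open>Classification of the Real structures\<close>

theorem corollaryA20:
  fixes \<sigma> :: "('h::complex_hilbert_space \<Rightarrow> 'h) \<times> ('h \<Rightarrow> 'h) \<Rightarrow> ('h \<Rightarrow> 'h) \<times> ('h \<Rightarrow> 'h)"
  assumes "separable_space (euclidean :: 'h topology)"
    and "infinite_dimensional TYPE('h)"
    and "real_structure K_odd \<sigma>"
  shows "\<exists>J :: 'h \<Rightarrow> 'h. antiunitary J \<and> (J \<circ> J = id \<or> J \<circ> J = uminus) \<and>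
    (real_graded_isomorphic (K_odd, \<sigma>)
       (compact_operators \<otimes>\<^sub>g Cl1, tensor_conj_map compact_operators Cl1 (Ad J) cl01) \<or>
     real_graded_isomorphic (K_odd, \<sigma>)
       (compact_operators \<otimes>\<^sub>g Cl1, tensor_conj_map compact_operators Cl1 (Ad J) cl10))"
proof -
  interpret K_odd_real_structure \<sigma> by unfold_locales (rule assms(3))
  have "\<exists>x :: 'h. x \<noteq> 0"
  proof (rule ccontr)
    assume "\<not> ?thesis"
    then have "complex_vector.span {0 :: 'h} = UNIV" by (auto intro: complex_vector.span_base)
    then show False using assms(2) by (auto simp: infinite_dimensional_def)
  qed
  then obtain J where J: "antiunitary J" "J \<circ> J = id \<or> J \<circ> J = uminus"
    and \<sigma>: "(\<forall>a b. compact_operator a \<longrightarrow> compact_operator b \<longrightarrow> \<sigma> (a, b) = (Ad J a, Ad J b)) \<or>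
      (\<forall>a b. compact_operator a \<longrightarrow> compact_operator b \<longrightarrow> \<sigma> (a, b) = (Ad J b, Ad J a))"
    using K_odd_real_structure_classification[OF assms(3)] by blast
  have Ad_compact: "compact_operator (Ad J a)" if "compact_operator a" for a
    using \<sigma> compact[OF that that] that by fastforce
  from \<sigma> show ?thesis
  proof
    assume "\<forall>a b. compact_operator a \<longrightarrow> compact_operator b \<longrightarrow> \<sigma> (a, b) = (Ad J a, Ad J b)"
    then have "real_graded_isomorphic (K_odd, \<sigma>)
       (compact_operators \<otimes>\<^sub>g Cl1, tensor_conj_map compact_operators Cl1 (Ad J) cl01)"
      by (intro real_graded_isomorphic_tensorI[where w = fst and w' = snd] J(1) Ad_compact)
        (simp_all add: cl01_def split_beta compact_operator_coord)
    then show ?thesis using J by blast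
  next
    assume "\<forall>a b. compact_operator a \<longrightarrow> compact_operator b \<longrightarrow> \<sigma> (a, b) = (Ad J b, Ad J a)"
    then have "real_graded_isomorphic (K_odd, \<sigma>)
       (compact_operators \<otimes>\<^sub>g Cl1, tensor_conj_map compact_operators Cl1 (Ad J) cl10)"
      by (intro real_graded_isomorphic_tensorI[where w = snd and w' = fst] J(1) Ad_compact)
        (simp_all add: cl10_def split_beta compact_operator_coord)
    then show ?thesis using J by blast
  qed
qed

end
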